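(* Consider the family of load balancing systems with $n$ queues operating under Join the Shortest Queue (JSQ), parametrized by $\epsilon\in(0,\mu_\Sigma)$, with total arrival rate $\lambda^{(\epsilon)}=\mu_\Sigma-\epsilon$ (all objects as defined in the context). Then there exist a constant $\beta_{JSQ}$ (independent of $\epsilon$) and $\epsilon_0\in(0,\mu_\Sigma)$ such that for all $\epsilon \in (0,\epsilon_0)$, $$\left|\mathbb{E}\left[\sum_{i=1}^n\overline{q}_i^{(\epsilon)}\right]-\frac{1}{2\epsilon}\left(\left(\sigma_a^{(\epsilon)}\right)^2+\sum_{i=1}^n\sigma_{s_i}^2\right)\right|\le\beta_{JSQ}\log\left(\frac1\epsilon\right).$$
   Context: Load balancing system. There are $n$ queues in discrete time $k\in\mathbb{Z}_+$, each with its own server. $q_i(k)$ denotes the number of jobs in queue $i$ at the start of slot $k$. A single stream of arrivals $\{a(k):k\in\mathbb{Z}_+\}$, an i.i.d. sequence of nonnegative integer random variables, enters a dispatcher. Under JSQ the dispatcher routes the arrivals of slot $k$ to the queue with the smallest number of jobs. $\boldsymbol{a}(k)=(a_1(k),\dots,a_n(k))$ is the vector of arrivals to the queues after routing, so $a(k)=\sum_{i=1}^n a_i(k)$. After routing, jobs cannot change queues. The potential service vectors $\{\boldsymbol{s}(k):k\in\mathbb{Z}_+\}$ are an i.i.d. sequence of random vectors, independent of the arrival process. There are finite constants $A_{\max},S_{\max}$ with $a(1)\le A_{\max}$ and $s_i(1)\le S_{\max}$ for all $i$ with probability 1. The unused service $u_i(k)\ge 0$ is the difference between potential and actual service. The dynamics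 are $q_i(k+1)=q_i(k)+a_i(k)-s_i(k)+u_i(k)$ with $q_i(k+1)u_i(k)=0$ for all $i,k$, i.e. $u_i(k)=\max\{s_i(k)-q_i(k)-a_i(k),0\}$. Let $\mu_i=\mathbb{E}[s_i(1)]$, $\sigma_{s_i}^2=\mathrm{Var}[s_i(1)]$ and $\mu_\Sigma=\sum_{i=1}^n\mu_i$. The $\epsilon$-th system, $\epsilon\in(0,\mu_\Sigma)$, has arrival process $a^{(\epsilon)}(k)$ with $\lambda^{(\epsilon)}=\mathbb{E}[a^{(\epsilon)}(1)]=\mu_\Sigma-\epsilon$ and $(\sigma_a^{(\epsilon)})^2=\mathrm{Var}[a^{(\epsilon)}(1)]$. The constants $A_{\max},S_{\max}$ and the service distribution do not depend on $\epsilon$. $\overline{\boldsymbol{q}}^{(\epsilon)}$ denotes the steady-state queue length vector (the limit in distribution of $\boldsymbol{q}^{(\epsilon)}(k)$ as $k\to\infty$).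
   Formalization: The formal theorem adds that the potential services of different servers are uncorrelated (for s_1=s_2 random the formula fails by order 1/ε) and that every service rate μ_i is positive (with μ_i=0 the steady state may depend on q(0)). *)

theory Defs
  imports "HOL-Probability.Probability"
begin

(* Convergence in distribution of the random elements X k to the law N, tested on bounded
   continuous functions. (The library's weak_conv_m only covers laws on the real line.) On
   nat ^ 'n the topology is discrete, so there every bounded real function is a test function. *)
definition converges_in_distribution ::
    "'w measure \<Rightarrow> (nat \<Rightarrow> 'w \<Rightarrow> 'b::topological_space) \<Rightarrow> 'b measure \<Rightarrow> bool" where
  "converges_in_distribution M X N \<longleftrightarrow>
     (\<forall>f::'b \<Rightarrow> real. continuous_on UNIV f \<longrightarrow> bounded (range f) \<longrightarrow>
        (\<lambda>k. \<integral>\<omega>. f (X k \<omega>) \<partial>M) \<longlonglongrightarrow> (\<integral>x. f x \<partial>N))"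

(* Like indep_var, which requires both random elements to have the same type. *)
definition (in prob_space) indep_rvs ::
    "'b measure \<Rightarrow> ('a \<Rightarrow> 'b) \<Rightarrow> 'c measure \<Rightarrow> ('a \<Rightarrow> 'c) \<Rightarrow> bool" where
  "indep_rvs N X N' Y \<longleftrightarrow> X \<in> measurable M N \<and> Y \<in> measurable M N' \<and>
     indep_set {X -` A \<inter> space M | A. A \<in> sets N} {Y -` B \<inter> space M | B. B \<in> sets N'}"

lemma (in prob_space) indep_rvs_eq_indep_var:
  fixes X Y :: "'a \<Rightarrow> 'b"
  shows "indep_rvs N X N' Y \<longleftrightarrow> indep_var N X N' Y"
proof (cases "X \<in> measurable M N \<and> Y \<in> measurable M N'")
  case True
  have "sigma_sets (space M) {Z -` A \<inter> space M | A. A \<in> sets L} = {Z -` A \<inter> space M | A. A \<in> sets L}"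
    if "Z \<in> measurable M L" for Z :: "'a \<Rightarrow> 'b" and L
    using that sets_vimage_algebra2[of Z "space M" L] sets.sigma_sets_eq[of "vimage_algebra (space M) Z L"]
    by (auto simp: measurable_def)
  with True show ?thesis
    unfolding indep_rvs_def indep_var_eq by simp
qed (auto simp: indep_rvs_def indep_var_eq)

(* Discrete-time load balancing under Join the Shortest Queue. The servers are the elements of
   the finite type 'n.
     a k:  arrivals to the dispatcher in slot k      av k:  arrivals to the queues after routing
     s k:  potential service                         u k:   unused service
     q k:  queue lengths at the start of slot k
   All state spaces are countable, hence carry the discrete sigma-algebra. *)
locale jsq_system = prob_space M
  for M :: "'w measure" +
  fixes a :: "nat \<Rightarrow> 'w \<Rightarrow> nat"
    and s :: "nat \<Rightarrow> 'w \<Rightarrow> nat ^ 'n"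
    and av :: "nat \<Rightarrow> 'w \<Rightarrow> nat ^ 'n"
    and u :: "nat \<Rightarrow> 'w \<Rightarrow> nat ^ 'n"
    and q :: "nat \<Rightarrow> 'w \<Rightarrow> nat ^ 'n"
  assumes arrivals_indep: "indep_vars (\<lambda>_. count_space UNIV) a UNIV"
    and arrivals_ident: "\<And>k. distr M (count_space UNIV) (a k) = distr M (count_space UNIV) (a 1)"
    and services_indep: "indep_vars (\<lambda>_. count_space UNIV) s UNIV"
    and services_ident: "\<And>k. distr M (count_space UNIV) (s k) = distr M (count_space UNIV) (s 1)"
    and arrivals_services_indep:
      "indep_rvs (\<Pi>\<^sub>M k\<in>UNIV. count_space UNIV) (\<lambda>\<omega> k. a k \<omega>)
                 (\<Pi>\<^sub>M k\<in>UNIV. count_space UNIV) (\<lambda>\<omega> k. s k \<omega>)"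
    (* The input of slot k is independent of the past: the initial state and the tie-breaking
       may be random, but neither anticipates the arrivals and services of later slots. *)
    and nonanticipating: "\<And>k.
      indep_rvs (count_space UNIV)
                  (\<lambda>\<omega>. (q k \<omega>, map (\<lambda>j. (q j \<omega>, a j \<omega>, av j \<omega>, s j \<omega>)) [0..<k]))
                (count_space UNIV) (\<lambda>\<omega>. (a k \<omega>, s k \<omega>))"
    (* Ties may be broken in any way. *)
    and jsq: "\<And>k \<omega>. \<omega> \<in> space M \<Longrightarrow>
      \<exists>i. (\<forall>j. q k \<omega> $ i \<le> q k \<omega> $ j) \<and> av k \<omega> = (\<chi> j. if j = i then a k \<omega> else 0)"
    (* The service term stands on the left because subtraction on nat truncates. *)
    and dynamics: "\<And>k \<omega> i. \<omega> \<in> space M \<Longrightarrow>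
      q (Suc k) \<omega> $ i + s k \<omega> $ i = q k \<omega> $ i + av k \<omega> $ i + u k \<omega> $ i"
    and unused: "\<And>k \<omega> i. \<omega> \<in> space M \<Longrightarrow> q (Suc k) \<omega> $ i * u k \<omega> $ i = 0"
begin

lemma unused_eq:
  assumes "\<omega> \<in> space M"
  shows "int (u k \<omega> $ i) = max (int (s k \<omega> $ i) - int (q k \<omega> $ i) - int (av k \<omega> $ i)) 0"
  using dynamics[OF assms, of k i] unused[OF assms, of k i] by auto

lemma arrivals_split:
  assumes "\<omega> \<in> space M"
  shows "a k \<omega> = (\<Sum>i\<in>UNIV. av k \<omega> $ i)"
  using jsq[OF assms, of k] by auto

end

definition service_mean :: "(nat ^ 'n) pmf \<Rightarrow> 'n \<Rightarrow> real" where
  "service_mean S i = measure_pmf.expectation S (\<lambda>x. real (x $ i))"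

definition service_var :: "(nat ^ 'n) pmf \<Rightarrow> 'n \<Rightarrow> real" where
  "service_var S i = measure_pmf.variance S (\<lambda>x. real (x $ i))"

definition total_service_rate :: "(nat ^ 'n) pmf \<Rightarrow> real" where
  "total_service_rate S = (\<Sum>i\<in>UNIV. service_mean S i)"

end

theory Submission
  imports Defs
begin

text \<open>
  Write \<open>Q\<close> for the total queue length, \<open>A\<close> and \<open>\<Sigma>\<close> for the total arrivals and potential services of
  a slot and \<open>U\<close> for the total unused service, so that \<open>Q' = Q + (A - \<Sigma>) + U\<close>. Squaring gives
  \<open>Q'\<^sup>2 = Q\<^sup>2 + 2 Q (A - \<Sigma>) + (A - \<Sigma>)\<^sup>2 + 2 Q' U - U\<^sup>2\<close>. The input of a slot is independent of the past
  and \<open>A - \<Sigma>\<close> has mean \<open>- \<epsilon>\<close>, so in equilibrium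
  \<open>2 \<epsilon> E Q = E (A - \<Sigma>)\<^sup>2 + 2 E (Q' U) - E U\<^sup>2\<close>. The first term on the right is the sum of the
  variances plus \<open>\<epsilon>\<^sup>2\<close>, because the services are uncorrelated. Since the mean of \<open>Q\<close> is balanced,
  \<open>E U = \<epsilon>\<close>, and \<open>U\<close> is bounded, so \<open>E U\<^sup>2 = O(\<epsilon>)\<close>. Everything therefore rests on
  \<open>E (Q' U) = O(\<epsilon> log (1/\<epsilon>))\<close>.

  This comes from state space collapse. If \<open>U > 0\<close>, then some queue is empty after the slot, so the
  average queue is at most the distance \<open>W\<close> of the queue vector from the diagonal, and
  \<open>Q' U \<le> n W U\<close> (\<open>tot_idle_le\<close>). JSQ pushes the vector towards the diagonal with a strength that
  does not vanish as \<open>\<epsilon> \<rightarrow> 0\<close> (\<open>push_balanced_le\<close>), which yields a bound on \<open>E (exp (\<theta> W))\<close> with \<open>\<theta>\<close>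
  and the bound independent of \<open>\<epsilon>\<close> (\<open>exp_moment_bounds\<close>). Splitting at \<open>W = (2/\<theta>) log (1/\<epsilon>)\<close> bounds
  \<open>E (W U)\<close> by \<open>(2/\<theta>) log (1/\<epsilon>) E U\<close> plus a tail of order \<open>\<epsilon>\<close> (\<open>mult_le_log_plus_exp\<close>); this is the
  origin of the logarithm.

  Ties may be broken in a manner that depends on the past, so the queue process need not be
  Markov and no stationary version of it is at hand. The initial law may also lack moments. The
  argument is therefore not carried out for a stationary process:
  expectations are restricted to the event that the process starts with at most \<open>m\<close> jobs, on which
  every variable of a fixed slot is almost surely bounded; the balance equations are summed over the
  first \<open>T\<close> slots, where the boundary terms stay bounded; and the sums are compared with the
  limits of \<open>E (min Q N)\<close>, the only kind of information that convergence in distribution provides.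
  Letting \<open>T\<close>, then \<open>m\<close>, then \<open>N\<close> tend to infinity gives integrability and the upper bound. For the
  lower bound the error of capping at \<open>N\<close> is controlled by second moments that are averaged over
  time; they follow from the same exponential drift argument with the length of the queue vector in
  place of its distance from the diagonal, now with constants that depend on \<open>\<epsilon>\<close>
  (\<open>second_moment_bounds\<close>).
\<close>

section \<open>One slot of the dynamics\<close>

definition tot :: "nat ^ 'n \<Rightarrow> real" where
  "tot x = (\<Sum>i\<in>UNIV. real (x $ i))"

definition shortest :: "nat ^ 'n \<Rightarrow> real" where
  "shortest x = real (Min (range (($) x)))"

text \<open>Only two values of \<open>\<kappa>\<close> matter: for \<open>\<kappa> = 0\<close> this is the squared Euclidean length, for
  \<open>\<kappa> = 1 / n\<close> the squared distance from the diagonal. Between them the form stays positive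
  semidefinite, which is all that the drift estimate needs, so both are treated at once.\<close>
definition spread :: "real \<Rightarrow> nat ^ 'n \<Rightarrow> real" where
  "spread \<kappa> x = (\<Sum>i\<in>UNIV. (real (x $ i))\<^sup>2) - \<kappa> * (tot x)\<^sup>2"

text \<open>Half of the first-order change of \<^term>\<open>spread \<kappa>\<close> in a slot with \<open>a\<close> arrivals and services \<open>s\<close>.
  The arrivals always multiply the length of a shortest queue, whichever one is chosen, so the
  expression does not see how ties are broken. The arguments are real in order that means can be
  inserted.\<close>
definition push :: "real \<Rightarrow> nat ^ 'n \<Rightarrow> real \<Rightarrow> ('n \<Rightarrow> real) \<Rightarrow> real" where
  "push \<kappa> x a s = a * (shortest x - \<kappa> * tot x) - (\<Sum>i\<in>UNIV. s i * (real (x $ i) - \<kappa> * tot x))"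

text \<open>The existential quantifiers hide the choice among the shortest queues and the unused service, so
  that the relation involves nothing but queue lengths and inputs.\<close>
definition jsq_step :: "nat \<Rightarrow> nat ^ 'n \<Rightarrow> nat ^ 'n \<Rightarrow> nat \<Rightarrow> nat ^ 'n \<Rightarrow> bool" where
  "jsq_step B x y a s \<longleftrightarrow> a \<le> B \<and> (\<forall>i. s $ i \<le> B) \<and>
     (\<exists>l v u. (\<forall>j. x $ l \<le> x $ j) \<and> v = (\<chi> j. if j = l then a else 0) \<and>
        (\<forall>i. y $ i + s $ i = x $ i + v $ i + u $ i \<and> y $ i * u $ i = 0))"

text \<open>The total unused service, expressed through totals: a function of the queue lengths and inputs
  alone, and hence measurable along with them.\<close>
definition idle :: "nat ^ 'n \<Rightarrow> nat ^ 'n \<Rightarrow> nat \<Rightarrow> nat ^ 'n \<Rightarrow> real" where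
  "idle x y a s = tot y - tot x - real a + tot s"

lemma tot_nonneg [simp]: "0 \<le> tot x"
  by (simp add: tot_def sum_nonneg)

lemma le_tot: "real (x $ i) \<le> tot x"
  unfolding tot_def by (rule member_le_sum) auto

lemma shortest_le: "shortest x \<le> real (x $ i)"
  unfolding shortest_def by (simp add: Min_le)

lemma shortest_nonneg: "0 \<le> shortest x"
  by (simp add: shortest_def)

lemma shortest_eqI: "(\<And>j. x $ l \<le> x $ j) \<Longrightarrow> shortest x = real (x $ l)"
  unfolding shortest_def of_nat_eq_iff by (intro Min_eqI) auto

lemma finite_tot_le: "finite {x :: nat ^ 'n. tot x \<le> r}"
proof -
  have "{x :: nat ^ 'n. tot x \<le> r} \<subseteq> vec_lambda ` (UNIV \<rightarrow>\<^sub>E {..nat \<lceil>r\<rceil>})"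
  proof
    fix x :: "nat ^ 'n" assume x: "x \<in> {x. tot x \<le> r}"
    have "x $ i \<le> nat \<lceil>r\<rceil>" for i
      using le_tot[of x i] x by (simp add: le_nat_iff) linarith
    then have "($) x \<in> UNIV \<rightarrow>\<^sub>E {..nat \<lceil>r\<rceil>}" by auto
    then show "x \<in> vec_lambda ` (UNIV \<rightarrow>\<^sub>E {..nat \<lceil>r\<rceil>})"
      by (metis image_eqI vec_nth_inverse)
  qed
  then show ?thesis by (rule finite_subset) (intro finite_imageI finite_PiE, auto)
qed

lemma sum_sq_centred:
  fixes x :: "nat ^ 'n"
  shows "(\<Sum>i\<in>UNIV. (real (x $ i) - t)\<^sup>2)
    = (\<Sum>i\<in>UNIV. (real (x $ i))\<^sup>2) - 2 * t * tot x + real CARD('n) * t\<^sup>2"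
  by (simp add: power2_diff sum.distrib sum_subtractf tot_def sum_distrib_left algebra_simps)

text \<open>Expanding the square leaves \<open>- 2 \<kappa> + n \<kappa>\<^sup>2\<close> as the coefficient of the squared total, and
  \<open>n \<kappa>\<^sup>2 \<le> \<kappa>\<close>. In particular \<^const>\<open>spread\<close> is nonnegative.\<close>
lemma sum_sq_centred_le_spread:
  fixes x :: "nat ^ 'n"
  assumes "0 \<le> \<kappa>" "\<kappa> * real CARD('n) \<le> 1"
  shows "(\<Sum>i\<in>UNIV. (real (x $ i) - \<kappa> * tot x)\<^sup>2) \<le> spread \<kappa> x"
proof -
  have "\<kappa> * (\<kappa> * real CARD('n)) * (tot x)\<^sup>2 \<le> \<kappa> * 1 * (tot x)\<^sup>2"
    using assms by (intro mult_right_mono mult_left_mono) auto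
  then show ?thesis
    unfolding sum_sq_centred spread_def by (simp add: power2_eq_square algebra_simps)
qed

lemma deviation_le_spread:
  fixes x :: "nat ^ 'n"
  assumes "0 \<le> \<kappa>" "\<kappa> * real CARD('n) \<le> 1"
  shows "(real (x $ i) - \<kappa> * tot x)\<^sup>2 \<le> spread \<kappa> x"
  using member_le_sum[of i UNIV "\<lambda>i. (real (x $ i) - \<kappa> * tot x)\<^sup>2"]
    sum_sq_centred_le_spread[OF assms, of x] by auto

lemma spread_nonneg:
  fixes x :: "nat ^ 'n"
  assumes "0 \<le> \<kappa>" "\<kappa> * real CARD('n) \<le> 1"
  shows "0 \<le> spread \<kappa> x"
  using deviation_le_spread[OF assms, of x undefined] zero_le_power2 order_trans by blast

lemma jsq_stepE:
  fixes x y :: "nat ^ 'n"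
  assumes "jsq_step B x y a s"
  obtains l u where "shortest x = real (x $ l)"
    "\<And>i. real (y $ i) = real (x $ i) + (if i = l then real a else 0) - real (s $ i) + u i"
    "\<And>i. 0 \<le> u i" "\<And>i. u i \<le> real (s $ i)" "\<And>i. real (y $ i) * u i = 0"
    "idle x y a s = sum u UNIV"
proof -
  obtain l and u :: "nat ^ 'n" where l: "\<And>j. x $ l \<le> x $ j"
    and dyn: "\<And>i. y $ i + s $ i = x $ i + (if i = l then a else 0) + u $ i"
    and un: "\<And>i. y $ i * u $ i = 0"
    using assms unfolding jsq_step_def by force
  have dynr: "real (y $ i) = real (x $ i) + (if i = l then real a else 0) - real (s $ i) + real (u $ i)" for i
    using dyn[of i] by (auto simp: algebra_simps split: if_splits simp flip: of_nat_add)
  have "u $ i \<le> s $ i" for i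
    using dyn[of i] un[of i] by auto
  moreover have "idle x y a s = (\<Sum>i\<in>UNIV. real (u $ i))"
    unfolding idle_def tot_def by (simp add: dynr sum.distrib sum_subtractf)
  moreover have "real (y $ i) * real (u $ i) = 0" for i
    using un[of i] by simp
  ultimately show thesis
    by (intro that[of l "\<lambda>i. real (u $ i)", OF shortest_eqI[OF l] dynr]) auto
qed

lemma jsq_step_tot_services_le:
  fixes x :: "nat ^ 'n"
  assumes "jsq_step B x y a s"
  shows "tot s \<le> real CARD('n) * real B"
  using assms unfolding jsq_step_def tot_def
  by (intro sum_bounded_above) auto

lemma idle_nonneg:
  assumes "jsq_step B x y a s" shows "0 \<le> idle x y a s"
  using assms by (elim jsq_stepE) (simp add: sum_nonneg)

lemma idle_le:
  fixes x :: "nat ^ 'n"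
  assumes "jsq_step B x y a s" shows "idle x y a s \<le> real CARD('n) * real B"
  using assms
proof (elim jsq_stepE)
  fix u :: "'n \<Rightarrow> real" assume "\<And>i. u i \<le> real (s $ i)" "idle x y a s = sum u UNIV"
  then have "idle x y a s \<le> tot s" by (simp add: tot_def sum_mono)
  then show ?thesis using jsq_step_tot_services_le[OF assms] by simp
qed

lemma jsq_step_tot_le:
  fixes x y :: "nat ^ 'n"
  assumes "jsq_step B x y a s" shows "tot y \<le> tot x + real B"
  using assms
proof (elim jsq_stepE)
  fix u :: "'n \<Rightarrow> real" assume "\<And>i. u i \<le> real (s $ i)" "idle x y a s = sum u UNIV"
  then have "idle x y a s \<le> tot s" by (simp add: tot_def sum_mono)
  moreover have "real a \<le> real B" using assms by (simp add: jsq_step_def)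
  ultimately show ?thesis by (simp add: idle_def)
qed

text \<open>A server idles only if its queue is empty after the slot. The deviation of that queue from the
  average is then the average itself, so the distance from the diagonal bounds the average queue.\<close>
lemma tot_idle_le:
  fixes x y :: "nat ^ 'n"
  assumes "jsq_step B x y a s"
  shows "tot y * idle x y a s \<le> real CARD('n) * sqrt (1 + spread (1 / real CARD('n)) y) * idle x y a s"
proof (cases "idle x y a s = 0")
  case False
  from assms obtain u where "\<And>i. real (y $ i) * u i = 0" "idle x y a s = sum u UNIV"
    by (elim jsq_stepE) auto
  with False obtain i where "y $ i = 0"
    by (metis mult_eq_0_iff of_nat_eq_0_iff sum.neutral)
  then have "(tot y / real CARD('n))\<^sup>2 \<le> 1 + spread (1 / real CARD('n)) y"
    using deviation_le_spread[of "1 / real CARD('n)" y i] by auto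
  then have "tot y / real CARD('n) \<le> sqrt (1 + spread (1 / real CARD('n)) y)"
    by (rule real_le_rsqrt)
  then have "tot y \<le> real CARD('n) * sqrt (1 + spread (1 / real CARD('n)) y)"
    by (simp add: divide_le_eq mult.commute)
  then show ?thesis
    using idle_nonneg[OF assms] by (rule mult_right_mono)
qed simp

lemma sum_sq_le_card:
  fixes u :: "'n::finite \<Rightarrow> real"
  shows "(sum u UNIV)\<^sup>2 \<le> real CARD('n) * (\<Sum>i\<in>UNIV. (u i)\<^sup>2)"
  using sum_squared_le_sum_of_squares[of u UNIV] by (simp add: mult.commute)

text \<open>The unused service can only help. Passing from \<open>y - u\<close> to \<open>y\<close> changes the form by twice the
  bilinear form at \<open>y\<close> and \<open>u\<close>, minus the form at \<open>u\<close>; since \<open>y \<bullet> u = 0\<close>, the bilinear form is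
  \<open>- \<kappa> tot y tot u \<le> 0\<close>. It remains to expand at \<open>x\<close> plus the net input, whose own form is
  bounded.\<close>
lemma spread_step_le:
  fixes x :: "nat ^ 'n"
  assumes \<kappa>: "0 \<le> \<kappa>" "\<kappa> * real CARD('n) \<le> 1" and st: "jsq_step B x y a s"
  shows "spread \<kappa> y \<le> spread \<kappa> x + 2 * push \<kappa> x (real a) (\<lambda>i. real (s $ i)) + real CARD('n) * (2 * real B)\<^sup>2"
  using st
proof (elim jsq_stepE)
  fix l :: 'n and u :: "'n \<Rightarrow> real"
  assume l: "shortest x = real (x $ l)"
    and y: "\<And>i. real (y $ i) = real (x $ i) + (if i = l then real a else 0) - real (s $ i) + u i"
    and u: "\<And>i. 0 \<le> u i" "\<And>i. u i \<le> real (s $ i)" "\<And>i. real (y $ i) * u i = 0"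
    and id: "idle x y a s = sum u UNIV"
  define d where "d i = (if i = l then real a else 0) - real (s $ i)" for i
  have toty: "tot y = tot x + sum d UNIV + sum u UNIV"
    by (simp add: tot_def y d_def sum.distrib sum_subtractf)
  have "(\<Sum>i\<in>UNIV. (real (y $ i) - u i)\<^sup>2) = (\<Sum>i\<in>UNIV. (real (x $ i) + d i)\<^sup>2)"
    by (rule sum.cong) (auto simp: y d_def algebra_simps)
  then have sq: "(\<Sum>i\<in>UNIV. (real (y $ i))\<^sup>2) + (\<Sum>i\<in>UNIV. (u i)\<^sup>2)
      = (\<Sum>i\<in>UNIV. (real (x $ i))\<^sup>2) + 2 * (\<Sum>i\<in>UNIV. real (x $ i) * d i) + (\<Sum>i\<in>UNIV. (d i)\<^sup>2)"
    using u(3) by (simp add: power2_diff power2_sum sum.distrib sum_subtractf sum_distrib_left mult.assoc)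
  have xd: "(\<Sum>i\<in>UNIV. real (x $ i) * d i) = real a * shortest x - (\<Sum>i\<in>UNIV. real (s $ i) * real (x $ i))"
  proof -
    have "real (x $ i) * d i = (if i = l then real a * real (x $ i) else 0) - real (s $ i) * real (x $ i)" for i
      by (simp add: d_def algebra_simps)
    then show ?thesis by (simp add: l sum_subtractf)
  qed
  have sd: "sum d UNIV = real a - tot s"
    by (simp add: d_def sum_subtractf tot_def)
  have push: "push \<kappa> x (real a) (\<lambda>i. real (s $ i)) = (\<Sum>i\<in>UNIV. real (x $ i) * d i) - \<kappa> * tot x * sum d UNIV"
  proof -
    have lin: "(\<Sum>i\<in>UNIV. real (s $ i) * (real (x $ i) - t)) = (\<Sum>i\<in>UNIV. real (s $ i) * real (x $ i)) - t * tot s" for t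
      by (simp add: right_diff_distrib sum_subtractf tot_def sum_distrib_left mult.commute)
    show ?thesis
      unfolding push_def xd sd lin by (simp add: algebra_simps)
  qed
  have "\<bar>d i\<bar> \<le> 2 * real B" for i
    using st u by (auto simp: d_def jsq_step_def abs_le_iff intro: order_trans[of _ "real B"])
      (smt (verit) of_nat_0_le_iff of_nat_mono)+
  then have "(d i)\<^sup>2 \<le> (2 * real B)\<^sup>2" for i
    by (metis abs_ge_zero power2_abs power_mono)
  then have dd: "(\<Sum>i\<in>UNIV. (d i)\<^sup>2) \<le> real CARD('n) * (2 * real B)\<^sup>2"
    by (intro sum_bounded_above) auto
  have "\<kappa> * (sum u UNIV)\<^sup>2 \<le> \<kappa> * (real CARD('n) * (\<Sum>i\<in>UNIV. (u i)\<^sup>2))"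
    using \<kappa> sum_sq_le_card by (intro mult_left_mono)
  also have "\<dots> \<le> (\<Sum>i\<in>UNIV. (u i)\<^sup>2)"
    using mult_right_mono[OF \<kappa>(2), of "\<Sum>i\<in>UNIV. (u i)\<^sup>2"] by (simp add: sum_nonneg algebra_simps)
  finally have uu: "\<kappa> * (sum u UNIV)\<^sup>2 \<le> (\<Sum>i\<in>UNIV. (u i)\<^sup>2)" .
  have "0 \<le> \<kappa> * (tot y * sum u UNIV)" "0 \<le> \<kappa> * (sum d UNIV)\<^sup>2"
    using \<kappa> u by (auto simp: sum_nonneg)
  then show ?thesis
    using sq uu dd unfolding spread_def push toty
    by (simp add: power2_eq_square algebra_simps)
qed

lemma abs_push_le:
  fixes x :: "nat ^ 'n"
  assumes \<kappa>: "0 \<le> \<kappa>" "\<kappa> * real CARD('n) \<le> 1" and st: "jsq_step B x y a s"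
  shows "\<bar>push \<kappa> x (real a) (\<lambda>i. real (s $ i))\<bar>
    \<le> real (CARD('n) + 1) * real B * sqrt (1 + spread \<kappa> x)"
proof -
  let ?W = "sqrt (1 + spread \<kappa> x)"
  have dev: "\<bar>real (x $ i) - \<kappa> * tot x\<bar> \<le> ?W" for i
    using deviation_le_spread[OF \<kappa>, of x i] by (intro real_le_rsqrt) auto
  obtain l where l: "shortest x = real (x $ l)" using st by (elim jsq_stepE)
  have B: "real a \<le> real B" "\<And>i. real (s $ i) \<le> real B" using st by (auto simp: jsq_step_def)
  have "\<bar>push \<kappa> x (real a) (\<lambda>i. real (s $ i))\<bar>
    \<le> \<bar>real a * (shortest x - \<kappa> * tot x)\<bar> + (\<Sum>i\<in>UNIV. \<bar>real (s $ i) * (real (x $ i) - \<kappa> * tot x)\<bar>)"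
    unfolding push_def by (intro order_trans[OF abs_triangle_ineq4] add_mono sum_abs order_refl)
  also have "\<dots> \<le> real B * ?W + real CARD('n) * (real B * ?W)"
    using B dev unfolding l
    by (intro add_mono sum_bounded_above) (auto simp: abs_mult intro!: mult_mono)
  finally show ?thesis by (simp add: algebra_simps)
qed

text \<open>State space collapse at the level of means. Writing \<open>r\<close> for the excess of each queue over the
  shortest one, the left-hand side equals \<open>(\<epsilon> / n) \<Sum>r - \<Sum>\<mu>r\<close>: all servers work on their queues, but
  the arrivals go where the excess is zero. For small \<open>\<epsilon>\<close> half of the slowest service rate survives,
  and \<open>\<Sum>r\<close> dominates the distance from the diagonal.\<close>
lemma push_balanced_le:
  fixes x :: "nat ^ 'n" and \<mu> :: "'n \<Rightarrow> real"
  assumes \<mu>: "\<And>i. \<mu>0 \<le> \<mu> i" and e: "0 \<le> \<epsilon>" "2 * \<epsilon> \<le> real CARD('n) * \<mu>0"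
  shows "push (1 / real CARD('n)) x (sum \<mu> UNIV - \<epsilon>) \<mu> \<le> - (\<mu>0 / 2) * sqrt (spread (1 / real CARD('n)) x)"
proof -
  let ?n = "real CARD('n)"
  define r where "r i = real (x $ i) - shortest x" for i
  have r: "0 \<le> r i" for i using shortest_le[of x i] by (simp add: r_def)
  have sr: "sum r UNIV = tot x - ?n * shortest x"
    by (simp add: r_def sum_subtractf tot_def)
  have "spread (1 / ?n) x \<le> (\<Sum>i\<in>UNIV. (r i)\<^sup>2)"
  proof -
    have "0 \<le> (tot x - ?n * shortest x)\<^sup>2 / ?n" by simp
    then show ?thesis
      unfolding r_def sum_sq_centred spread_def by (simp add: power2_eq_square field_simps)
  qed
  also have "\<dots> \<le> (sum r UNIV)\<^sup>2"
    using L2_set_le_sum[of UNIV r] r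
    by (simp add: L2_set_def sum_nonneg real_sqrt_le_iff sqrt_le_D)
  finally have W: "sqrt (spread (1 / ?n) x) \<le> sum r UNIV"
    using r by (simp add: real_le_lsqrt sum_nonneg)
  have "push (1 / ?n) x (sum \<mu> UNIV - \<epsilon>) \<mu> = \<epsilon> / ?n * sum r UNIV - (\<Sum>i\<in>UNIV. \<mu> i * r i)"
  proof -
    have lin: "(\<Sum>i\<in>UNIV. \<mu> i * (real (x $ i) - t)) = (\<Sum>i\<in>UNIV. \<mu> i * real (x $ i)) - sum \<mu> UNIV * t" for t
      by (simp add: right_diff_distrib sum_subtractf sum_distrib_right)
    show ?thesis
      unfolding push_def sr r_def lin by (simp add: field_simps)
  qed
  also have "\<dots> \<le> \<mu>0 / 2 * sum r UNIV - (\<Sum>i\<in>UNIV. \<mu>0 * r i)"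
    using e \<mu> r by (intro diff_mono mult_right_mono sum_mono sum_nonneg) (auto simp: field_simps)
  also have "\<dots> = - (\<mu>0 / 2) * sum r UNIV" by (simp add: sum_distrib_left[symmetric])
  also have "\<dots> \<le> - (\<mu>0 / 2) * sqrt (spread (1 / ?n) x)"
  proof -
    have "0 \<le> ?n * \<mu>0" using e by linarith
    then have "0 \<le> \<mu>0" by (simp add: zero_le_mult_iff)
    then show ?thesis using W by (intro mult_left_mono_neg) auto
  qed
  finally show ?thesis .
qed

text \<open>Sending the arrivals to a shortest queue is no worse than spreading them so that each queue keeps
  the spare capacity \<open>\<delta>\<close>. In contrast to the distance from the diagonal, the strength of this drift is
  at most \<open>\<epsilon> / n\<close>.\<close>
lemma push_total_le:
  fixes x :: "nat ^ 'n" and \<mu> :: "'n \<Rightarrow> real"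
  assumes \<mu>: "\<And>i. \<delta> \<le> \<mu> i" and d: "0 \<le> \<delta>" "\<delta> * real CARD('n) \<le> \<epsilon>"
  shows "push 0 x (sum \<mu> UNIV - \<epsilon>) \<mu> \<le> - \<delta> * sqrt (spread 0 x)"
proof -
  have "sqrt (spread 0 x) \<le> tot x"
    using L2_set_le_sum[of UNIV "\<lambda>i. real (x $ i)"]
    by (simp add: L2_set_def tot_def spread_def)
  then have W: "- \<delta> * tot x \<le> - \<delta> * sqrt (spread 0 x)"
    using d by (intro mult_left_mono_neg) auto
  have "push 0 x (sum \<mu> UNIV - \<epsilon>) \<mu> = - \<epsilon> * shortest x - (\<Sum>i\<in>UNIV. \<mu> i * (real (x $ i) - shortest x))"
    unfolding push_def
    by (simp add: right_diff_distrib left_diff_distrib sum_subtractf sum_distrib_right[symmetric])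
  also have "\<dots> \<le> - (\<delta> * real CARD('n)) * shortest x - (\<Sum>i\<in>UNIV. \<delta> * (real (x $ i) - shortest x))"
    using d \<mu> shortest_le[of x] shortest_nonneg[of x]
    by (intro diff_mono sum_mono mult_right_mono) auto
  also have "\<dots> = - \<delta> * tot x"
    by (simp add: right_diff_distrib sum_subtractf tot_def sum_distrib_left sum_negf)
  finally show ?thesis using W by linarith
qed

section \<open>Exponential drift\<close>
lemma exp_le_quadratic:
  fixes x :: real
  assumes "\<bar>x\<bar> \<le> 1"
  shows "exp x \<le> 1 + x + x\<^sup>2"
proof (cases "0 \<le> x")
  case True then show ?thesis using assms exp_bound[of x] by simp
next
  case False
  have "1 - x \<le> exp (- x)" using exp_ge_add_one_self[of "- x"] by simp
  then have "exp x \<le> 1 / (1 - x)"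
    using False by (simp add: exp_minus field_simps)
  also have "\<dots> \<le> 1 + x + x\<^sup>2"
  proof -
    have "1 \<le> (1 + x + x\<^sup>2) * (1 - x)"
      using False mult_nonneg_nonneg[of "x\<^sup>2" "-x"] by (simp add: algebra_simps power2_eq_square)
    then show ?thesis using False by (simp add: divide_le_eq)
  qed
  finally show ?thesis .
qed

text \<open>The exponential is taken of \<open>W = sqrt (1 + V)\<close> and not of \<open>V\<close>, because \<open>W\<close> has bounded increments
  while \<open>V\<close> does not. By concavity \<open>W' - W \<le> (V' - V) / (2 W)\<close>, which is linear in \<open>D\<close>, so the mean of
  \<open>D\<close> can be inserted after the quadratic bound on the exponential. The summand 1 keeps \<open>W\<close> away from
  zero.\<close>
lemma exp_sqrt_step_le:
  fixes V V' D K b \<theta> :: real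
  assumes V: "0 \<le> V" "0 \<le> V'" "V' \<le> V + 2 * D + K" and D: "\<bar>D\<bar> \<le> b * sqrt (1 + V)"
    and K: "0 \<le> K" and \<theta>: "0 \<le> \<theta>" "\<theta> * (b + K) \<le> 1"
  shows "exp (\<theta> * sqrt (1 + V')) \<le> exp (\<theta> * sqrt (1 + V)) * (1 + \<theta>\<^sup>2 * (b + K)\<^sup>2)
     + \<theta> * (exp (\<theta> * sqrt (1 + V)) / sqrt (1 + V)) * (D + K / 2)"
proof -
  define W where "W = sqrt (1 + V)"
  define W' where "W' = sqrt (1 + V')"
  have W1: "1 \<le> W" using V by (simp add: W_def)
  have sq: "W\<^sup>2 = 1 + V" "W'\<^sup>2 = 1 + V'" using V by (auto simp: W_def W'_def)
  define Y where "Y = (D + K / 2) / W"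
  have "0 \<le> (W' - W)\<^sup>2" by simp
  then have "2 * W * (W' - W) \<le> 2 * D + K"
    using V(3) sq by (simp add: power2_eq_square algebra_simps)
  then have Y: "W' \<le> W + Y"
    using W1 by (simp add: Y_def field_simps)
  have "\<bar>D + K / 2\<bar> \<le> b * W + K * W"
    using D K W1 mult_left_mono[OF W1 K] by (auto simp: W_def abs_le_iff)
  then have Yb: "\<bar>Y\<bar> \<le> b + K"
    using W1 by (simp add: Y_def abs_divide divide_le_eq algebra_simps)
  have "\<bar>\<theta> * Y\<bar> \<le> \<theta> * (b + K)" using Yb \<theta> by (simp add: abs_mult mult_left_mono)
  then have q: "exp (\<theta> * Y) \<le> 1 + \<theta> * Y + (\<theta> * Y)\<^sup>2" "(\<theta> * Y)\<^sup>2 \<le> (\<theta> * (b + K))\<^sup>2"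
    using \<theta> exp_le_quadratic by (auto simp: abs_le_square_iff intro: power2_le_imp_le)
      (metis abs_ge_zero power2_abs power_mono)
  have "exp (\<theta> * W') \<le> exp (\<theta> * W) * exp (\<theta> * Y)"
    using Y \<theta> by (simp flip: exp_add add: mult_left_mono flip: distrib_left)
  also have "\<dots> \<le> exp (\<theta> * W) * (1 + \<theta> * Y + (\<theta> * (b + K))\<^sup>2)"
    using q by (intro mult_left_mono) auto
  also have "\<dots> = exp (\<theta> * W) * (1 + \<theta>\<^sup>2 * (b + K)\<^sup>2) + \<theta> * (exp (\<theta> * W) / W) * (D + K / 2)"
    unfolding Y_def power_mult_distrib by (simp add: algebra_simps add_divide_distrib)
  finally show ?thesis
    unfolding W_def W'_def .
qed

text \<open>The contraction obtained when \<open>D\<close> has mean at most \<open>- \<delta> (W - 1)\<close>: beyond the level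
  \<open>L = 4 (\<delta> + K) / \<delta>\<close> the drift beats the correction terms, and below it the exponential is bounded.
  The resulting constants depend on \<open>\<delta>\<close>, \<open>K\<close> and \<open>\<theta>\<close> only.\<close>
lemma exp_drift_le:
  fixes W \<theta> \<delta> K c :: real
  assumes W: "1 \<le> W" and \<theta>: "0 < \<theta>" "\<theta> * c\<^sup>2 \<le> \<delta> / 4" and \<delta>: "0 < \<delta>" and K: "0 \<le> K"
  shows "exp (\<theta> * W) * (1 + \<theta>\<^sup>2 * c\<^sup>2) + \<theta> * (exp (\<theta> * W) / W) * (- \<delta> * (W - 1) + K / 2)
    \<le> (1 - \<theta> * \<delta> / 2) * exp (\<theta> * W) + \<theta> * (\<delta> + K) * exp (\<theta> * (4 * (\<delta> + K) / \<delta>))"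
proof -
  let ?L = "4 * (\<delta> + K) / \<delta>"
  have c: "\<theta>\<^sup>2 * c\<^sup>2 \<le> \<theta> * (\<delta> / 4)"
    using mult_left_mono[OF \<theta>(2), of \<theta>] \<theta>(1) by (simp add: power2_eq_square algebra_simps)
  have "(- \<delta> * (W - 1) + K / 2) / W = - \<delta> + (\<delta> + K / 2) / W"
    using W by (simp add: field_simps)
  also have "\<dots> \<le> - \<delta> + (\<delta> + K) / W"
    using W K by (simp add: divide_right_mono)
  finally have d: "(- \<delta> * (W - 1) + K / 2) / W \<le> - \<delta> + (\<delta> + K) / W" .
  have *: "\<theta> * (exp (\<theta> * W) * ((\<delta> + K) / W - \<delta> / 4)) \<le> \<theta> * ((\<delta> + K) * exp (\<theta> * ?L))"
  proof (intro mult_left_mono)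
    show "exp (\<theta> * W) * ((\<delta> + K) / W - \<delta> / 4) \<le> (\<delta> + K) * exp (\<theta> * ?L)"
    proof (cases "?L \<le> W")
      case True
      then have "(\<delta> + K) / W - \<delta> / 4 \<le> 0" using W \<delta> by (simp add: field_simps)
      then have "exp (\<theta> * W) * ((\<delta> + K) / W - \<delta> / 4) \<le> 0"
        by (simp add: mult_nonneg_nonpos)
      also have "0 \<le> (\<delta> + K) * exp (\<theta> * ?L)" using \<delta> K by simp
      finally show ?thesis .
    next
      case False
      have "(\<delta> + K) / W \<le> \<delta> + K" using W \<delta> K by (simp add: divide_le_eq mult_le_cancel_left1)
      then have "(\<delta> + K) / W - \<delta> / 4 \<le> \<delta> + K" using \<delta> by linarith
      then have "exp (\<theta> * W) * ((\<delta> + K) / W - \<delta> / 4) \<le> exp (\<theta> * W) * (\<delta> + K)" by simp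
      also have "\<dots> \<le> exp (\<theta> * ?L) * (\<delta> + K)"
        using False \<theta> \<delta> K by (intro mult_right_mono iffD2[OF exp_le_cancel_iff] mult_left_mono) auto
      finally show ?thesis by (simp add: mult.commute)
    qed
  qed (use \<theta> in simp)
  have "exp (\<theta> * W) * (1 + \<theta>\<^sup>2 * c\<^sup>2) + \<theta> * (exp (\<theta> * W) / W) * (- \<delta> * (W - 1) + K / 2)
     = exp (\<theta> * W) * (1 + \<theta>\<^sup>2 * c\<^sup>2 + \<theta> * ((- \<delta> * (W - 1) + K / 2) / W))"
    using W by (simp add: field_simps)
  also have "\<dots> \<le> exp (\<theta> * W) * (1 + \<theta> * (\<delta> / 4) + \<theta> * (- \<delta> + (\<delta> + K) / W))"
    using c d \<theta> by (intro mult_left_mono add_mono order_refl) auto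
  also have "\<dots> = (1 - \<theta> * \<delta> / 2) * exp (\<theta> * W) + \<theta> * (exp (\<theta> * W) * ((\<delta> + K) / W - \<delta> / 4))"
    by (simp add: algebra_simps)
  finally show ?thesis using * by (simp add: algebra_simps)
qed

section \<open>Bounded JSQ systems\<close>
definition weight :: "real \<Rightarrow> nat ^ 'n \<Rightarrow> real" where
  "weight \<kappa> x = sqrt (1 + spread \<kappa> x)"

lemma (in prob_space) indep_rvs_compose:
  assumes "indep_rvs N X N' Y" "f \<in> measurable N L" "g \<in> measurable N' L'"
  shows "indep_rvs L (\<lambda>\<omega>. f (X \<omega>)) L' (\<lambda>\<omega>. g (Y \<omega>))"
proof -
  have m: "X \<in> measurable M N" "Y \<in> measurable M N'"
    and i: "indep_set {X -` A \<inter> space M | A. A \<in> sets N} {Y -` A \<inter> space M | A. A \<in> sets N'}"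
    using assms(1) unfolding indep_rvs_def by auto
  have sub: "{(\<lambda>\<omega>. h (Z \<omega>)) -` A \<inter> space M | A. A \<in> sets R} \<subseteq> {Z -` A \<inter> space M | A. A \<in> sets Q}"
    if "Z \<in> measurable M Q" "h \<in> measurable Q R" for Z h Q R
  proof
    fix D assume "D \<in> {(\<lambda>\<omega>. h (Z \<omega>)) -` A \<inter> space M | A. A \<in> sets R}"
    then obtain A where A: "A \<in> sets R" "D = (\<lambda>\<omega>. h (Z \<omega>)) -` A \<inter> space M" by auto
    have "D = Z -` (h -` A \<inter> space Q) \<inter> space M"
      using A(2) measurable_space[OF that(1)] by auto
    then show "D \<in> {Z -` A \<inter> space M | A. A \<in> sets Q}"
      using measurable_sets[OF that(2) A(1)] by blast
  qed
  show ?thesis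
    unfolding indep_rvs_def
  proof (intro conjI)
    show "indep_set {(\<lambda>\<omega>. f (X \<omega>)) -` A \<inter> space M | A. A \<in> sets L}
       {(\<lambda>\<omega>. g (Y \<omega>)) -` B \<inter> space M | B. B \<in> sets L'}"
      using i unfolding indep_set_def
      by (rule indep_sets_mono_sets) (use sub[OF m(1) assms(2)] sub[OF m(2) assms(3)] in \<open>auto split: bool.split\<close>)
  qed (use m assms in \<open>auto intro: measurable_compose\<close>)
qed

text \<open>The moments that enter the balance equations, with the service law replaced by its means \<open>\<mu>\<close>;
  \<open>v\<close> stands for the variance of the total arrivals minus the total services in a slot, whose mean
  is \<open>- \<epsilon>\<close>.\<close>
locale bounded_jsq_system = jsq_system M a s av u q
  for M :: "'w measure" and a :: "nat \<Rightarrow> 'w \<Rightarrow> nat" and s av u q :: "nat \<Rightarrow> 'w \<Rightarrow> nat ^ 'n" +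
  fixes B :: nat and \<mu> :: "'n \<Rightarrow> real" and \<epsilon> v :: real
  assumes arrivals_le: "\<And>k. AE \<omega> in M. a k \<omega> \<le> B"
    and services_le: "\<And>k i. AE \<omega> in M. s k \<omega> $ i \<le> B"
    and mean_arrival: "\<And>k. expectation (\<lambda>\<omega>. real (a k \<omega>)) = sum \<mu> UNIV - \<epsilon>"
    and mean_service: "\<And>k i. expectation (\<lambda>\<omega>. real (s k \<omega> $ i)) = \<mu> i"
    and mean_net_square: "\<And>k. expectation (\<lambda>\<omega>. (real (a k \<omega>) - tot (s k \<omega>))\<^sup>2) = v + \<epsilon>\<^sup>2"
begin

text \<open>The history up to slot \<open>k + 1\<close> is measurable for the discrete sigma-algebra, hence so is any
  function of it, without any countability argument for products.\<close>
lemma measurable_joint: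
  "(\<lambda>\<omega>. (q 0 \<omega>, q k \<omega>, q (Suc k) \<omega>, a k \<omega>, s k \<omega>)) \<in> measurable M (count_space UNIV)"
proof -
  define h :: "(nat ^ 'n) \<times> ((nat ^ 'n) \<times> nat \<times> (nat ^ 'n) \<times> (nat ^ 'n)) list \<Rightarrow> _"
    where "h = (\<lambda>(x, l). (fst (l ! 0), fst (l ! k), x, fst (snd (l ! k)), snd (snd (snd (l ! k)))))"
  have past: "(\<lambda>\<omega>. (q (Suc k) \<omega>, map (\<lambda>j. (q j \<omega>, a j \<omega>, av j \<omega>, s j \<omega>)) [0..<Suc k]))
      \<in> measurable M (count_space UNIV)"
    using nonanticipating[of "Suc k"] unfolding indep_rvs_def by (rule conjunct1)
  have "(\<lambda>\<omega>. h (q (Suc k) \<omega>, map (\<lambda>j. (q j \<omega>, a j \<omega>, av j \<omega>, s j \<omega>)) [0..<Suc k]))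
      \<in> measurable M (count_space UNIV)"
    by (rule measurable_compose[OF past]) simp
  moreover have "map f [0..<Suc k] ! j = f j" if "j \<le> k" for f :: "nat \<Rightarrow> 'z" and j
    using that nth_map_upt[of j "Suc k" 0 f] by (simp del: upt_Suc)
  then have "h (q (Suc k) \<omega>, map (\<lambda>j. (q j \<omega>, a j \<omega>, av j \<omega>, s j \<omega>)) [0..<Suc k])
      = (q 0 \<omega>, q k \<omega>, q (Suc k) \<omega>, a k \<omega>, s k \<omega>)" for \<omega>
    unfolding h_def prod.case by (simp del: upt_Suc)
  ultimately show ?thesis
    by (simp only:)
qed

lemma borel_measurable_joint_fun:
  fixes f :: "_ \<Rightarrow> _ \<Rightarrow> _ \<Rightarrow> _ \<Rightarrow> _ \<Rightarrow> real"
  shows "(\<lambda>\<omega>. f (q 0 \<omega>) (q k \<omega>) (q (Suc k) \<omega>) (a k \<omega>) (s k \<omega>)) \<in> borel_measurable M"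
  using measurable_compose[OF measurable_joint[of k],
      of "\<lambda>(z, x, y, a, s). f z x y a s" borel] by simp

lemma AE_jsq_step: "AE \<omega> in M. \<forall>k. jsq_step B (q k \<omega>) (q (Suc k) \<omega>) (a k \<omega>) (s k \<omega>)"
proof -
  have "AE \<omega> in M. \<forall>k. a k \<omega> \<le> B \<and> (\<forall>i. s k \<omega> $ i \<le> B)"
    using arrivals_le services_le by (simp add: AE_all_countable AE_conj_iff)
  with AE_space show ?thesis
  proof eventually_elim
    case (elim \<omega>)
    note \<omega> = elim(1)
    have "jsq_step B (q k \<omega>) (q (Suc k) \<omega>) (a k \<omega>) (s k \<omega>)" for k
    proof -
      obtain l where l: "\<And>j. q k \<omega> $ l \<le> q k \<omega> $ j" "av k \<omega> = (\<chi> j. if j = l then a k \<omega> else 0)"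
        using jsq[OF \<omega>, of k] by blast
      show ?thesis unfolding jsq_step_def
        using elim l dynamics[OF \<omega>, of k] unused[OF \<omega>, of k]
        by (intro conjI exI[of _ l] exI[of _ "av k \<omega>"] exI[of _ "u k \<omega>"]) auto
    qed
    then show ?case by blast
  qed
qed

text \<open>The initial law may have no moments, so expectations are restricted to starts with at most \<open>m\<close>
  jobs. The event is the same in every slot, so the balance equations telescope over time without
  the error terms that truncating the current queue length would cause; and it belongs to the past of
  every slot, so the input stays independent of it.\<close>
definition started_exp :: "real \<Rightarrow> nat \<Rightarrow> (nat ^ 'n \<Rightarrow> nat ^ 'n \<Rightarrow> nat \<Rightarrow> nat ^ 'n \<Rightarrow> real) \<Rightarrow> real" where
  "started_exp m k F = expectation (\<lambda>\<omega>. of_bool (tot (q 0 \<omega>) \<le> m) * F (q k \<omega>) (q (Suc k) \<omega>) (a k \<omega>) (s k \<omega>))"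

definition start_prob :: "real \<Rightarrow> real" where
  "start_prob m = expectation (\<lambda>\<omega>. of_bool (tot (q 0 \<omega>) \<le> m))"

text \<open>From a bounded start only finitely many states are reachable within \<open>k + 1\<close> slots, so
  integrability holds for every function of the slot.\<close>
lemma integrable_started [simp, intro]:
  "integrable M (\<lambda>\<omega>. of_bool (tot (q 0 \<omega>) \<le> m) * F (q k \<omega>) (q (Suc k) \<omega>) (a k \<omega>) (s k \<omega>) :: real)"
proof -
  define R where "R = m + real (Suc k) * real B"
  define Z where "Z = {x :: nat ^ 'n. tot x \<le> R} \<times> {y :: nat ^ 'n. tot y \<le> R} \<times> {..B}
     \<times> {s :: nat ^ 'n. tot s \<le> real CARD('n) * real B}"
  have Z: "finite Z" unfolding Z_def by (intro finite_SigmaI finite_tot_le) auto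
  define C where "C = (\<Sum>(x, y, a, s)\<in>Z. \<bar>F x y a s\<bar>)"
  have C0: "0 \<le> C" unfolding C_def by (intro sum_nonneg) auto
  have "AE \<omega> in M. norm (of_bool (tot (q 0 \<omega>) \<le> m) * F (q k \<omega>) (q (Suc k) \<omega>) (a k \<omega>) (s k \<omega>)) \<le> C"
    using AE_jsq_step
  proof eventually_elim
    case (elim \<omega>)
    have step: "jsq_step B (q j \<omega>) (q (Suc j) \<omega>) (a j \<omega>) (s j \<omega>)" for j
      using elim by blast
    have grow: "tot (q j \<omega>) \<le> tot (q 0 \<omega>) + real j * real B" for j
    proof (induction j)
      case (Suc j) then show ?case
        using jsq_step_tot_le[OF step[of j]] by (simp add: algebra_simps)
    qed simp
    show ?case
    proof (cases "tot (q 0 \<omega>) \<le> m")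
      case True
      have "(q k \<omega>, q (Suc k) \<omega>, a k \<omega>, s k \<omega>) \<in> Z"
        using True grow[of k] grow[of "Suc k"] step[of k] jsq_step_tot_services_le[OF step[of k]]
        by (simp add: Z_def R_def jsq_step_def algebra_simps)
      from member_le_sum[OF this _ Z, of "\<lambda>(x, y, a, s). \<bar>F x y a s\<bar>"]
      show ?thesis using True by (auto simp: C_def)
    qed (simp add: C0)
  qed
  then show ?thesis
    by (rule integrable_const_bound) (rule borel_measurable_joint_fun[of "\<lambda>z x y a s. of_bool (tot z \<le> m) * F x y a s"])
qed

lemma integrable_input:
  "integrable M (\<lambda>\<omega>. g (a k \<omega>) (s k \<omega>) :: real)"
proof -
  define Z where "Z = {..B} \<times> {s :: nat ^ 'n. tot s \<le> real CARD('n) * real B}"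
  have Z: "finite Z" unfolding Z_def by (intro finite_SigmaI finite_tot_le) auto
  define C where "C = (\<Sum>(a, s)\<in>Z. \<bar>g a s\<bar>)"
  have "AE \<omega> in M. norm (g (a k \<omega>) (s k \<omega>)) \<le> C"
    using AE_jsq_step
  proof eventually_elim
    case (elim \<omega>)
    have step: "jsq_step B (q k \<omega>) (q (Suc k) \<omega>) (a k \<omega>) (s k \<omega>)"
      using elim by blast
    have "(a k \<omega>, s k \<omega>) \<in> Z"
      using step jsq_step_tot_services_le[OF step] by (simp add: Z_def jsq_step_def)
    from member_le_sum[OF this _ Z, of "\<lambda>(a, s). \<bar>g a s\<bar>"]
    show ?case by (auto simp: C_def)
  qed
  then show ?thesis
    by (rule integrable_const_bound) (rule borel_measurable_joint_fun[of "\<lambda>z x y a s. g a s"])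
qed

lemma start_prob_bounds: "0 \<le> start_prob m" "start_prob m \<le> 1"
  unfolding start_prob_def using integrable_started[of m "\<lambda>_ _ _ _. 1" 0]
  by (auto intro!: integral_nonneg_AE integral_le_const)

lemma started_exp_const [simp]: "started_exp m k (\<lambda>_ _ _ _. c) = c * start_prob m"
  by (simp add: started_exp_def start_prob_def mult.commute)

lemma started_exp_add:
  "started_exp m k (\<lambda>x y a s. F x y a s + H x y a s) = started_exp m k F + started_exp m k H"
  unfolding started_exp_def distrib_left by (rule Bochner_Integration.integral_add) auto

lemma started_exp_diff:
  "started_exp m k (\<lambda>x y a s. F x y a s - H x y a s) = started_exp m k F - started_exp m k H"
  unfolding started_exp_def right_diff_distrib by (rule Bochner_Integration.integral_diff) auto

lemma started_exp_cmult:
  "started_exp m k (\<lambda>x y a s. c * F x y a s) = c * started_exp m k F"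
  unfolding started_exp_def mult.left_commute[of _ c] by simp

lemma started_exp_sum:
  "started_exp m k (\<lambda>x y a s. \<Sum>i\<in>I. F i x y a s) = (\<Sum>i\<in>I. started_exp m k (F i))"
  unfolding started_exp_def sum_distrib_left by (rule Bochner_Integration.integral_sum) auto

lemma started_exp_mono:
  assumes "\<And>x y a s. jsq_step B x y a s \<Longrightarrow> F x y a s \<le> H x y a s"
  shows "started_exp m k F \<le> started_exp m k H"
  unfolding started_exp_def
proof (rule integral_mono_AE)
  show "AE \<omega> in M. of_bool (tot (q 0 \<omega>) \<le> m) * F (q k \<omega>) (q (Suc k) \<omega>) (a k \<omega>) (s k \<omega>)
      \<le> of_bool (tot (q 0 \<omega>) \<le> m) * H (q k \<omega>) (q (Suc k) \<omega>) (a k \<omega>) (s k \<omega>)"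
    using AE_jsq_step by eventually_elim (use assms in \<open>auto intro!: mult_left_mono\<close>)
qed auto

lemma started_exp_nonneg:
  assumes "\<And>x y a s. jsq_step B x y a s \<Longrightarrow> 0 \<le> F x y a s"
  shows "0 \<le> started_exp m k F"
  using started_exp_mono[of "\<lambda>_ _ _ _. 0" F m k] assms by simp

lemma started_exp_Suc:
  "started_exp m (Suc k) (\<lambda>x _ _ _. f x) = started_exp m k (\<lambda>_ y _ _. f y)"
  by (simp add: started_exp_def)

lemma started_exp_indep:
  "started_exp m k (\<lambda>x _ a s. h x * g a s)
    = started_exp m k (\<lambda>x _ _ _. h x) * expectation (\<lambda>\<omega>. g (a k \<omega>) (s k \<omega>))"
proof -
  define H :: "(nat ^ 'n) \<times> ((nat ^ 'n) \<times> nat \<times> (nat ^ 'n) \<times> (nat ^ 'n)) list \<Rightarrow> real"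
    where "H = (\<lambda>(x, l). of_bool (tot (if k = 0 then x else fst (l ! 0)) \<le> m) * h x)"
  have H: "H (q k \<omega>, map (\<lambda>j. (q j \<omega>, a j \<omega>, av j \<omega>, s j \<omega>)) [0..<k])
      = of_bool (tot (q 0 \<omega>) \<le> m) * h (q k \<omega>)" for \<omega>
    by (simp add: H_def)
  have "indep_rvs borel (\<lambda>\<omega>. H (q k \<omega>, map (\<lambda>j. (q j \<omega>, a j \<omega>, av j \<omega>, s j \<omega>)) [0..<k]))
      borel (\<lambda>\<omega>. (\<lambda>(a, s). g a s) (a k \<omega>, s k \<omega>))"
    by (rule indep_rvs_compose[OF nonanticipating]) auto
  then have "indep_var borel (\<lambda>\<omega>. of_bool (tot (q 0 \<omega>) \<le> m) * h (q k \<omega>))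
      borel (\<lambda>\<omega>. g (a k \<omega>) (s k \<omega>))"
    unfolding H by (simp add: indep_rvs_eq_indep_var)
  from indep_var_lebesgue_integral[OF this integrable_started[of m "\<lambda>x _ _ _. h x"] integrable_input]
  show ?thesis by (simp add: started_exp_def mult.assoc)
qed

text \<open>\<^const>\<open>push\<close> is a sum of products of a function of the queue lengths and one input, and the input of
  the slot is independent of the past: the inputs may be replaced by their means.\<close>
lemma started_exp_push:
  "started_exp m k (\<lambda>x _ a s. h x * push \<kappa> x (real a) (\<lambda>i. real (s $ i)))
    = started_exp m k (\<lambda>x _ _ _. h x * push \<kappa> x (sum \<mu> UNIV - \<epsilon>) \<mu>)"
proof -
  have split: "h x * push \<kappa> x \<alpha> \<sigma> = (h x * (shortest x - \<kappa> * tot x)) * \<alpha>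
      - (\<Sum>i\<in>UNIV. (h x * (real (x $ i) - \<kappa> * tot x)) * \<sigma> i)" for x :: "nat ^ 'n" and \<alpha> \<sigma>
    by (simp add: push_def right_diff_distrib sum_distrib_left mult_ac)
  show ?thesis
    unfolding split started_exp_diff started_exp_sum
    by (subst (1 2) started_exp_indep) (simp add: mean_arrival mean_service mult.commute[of _ "\<mu> _"]
        mult.commute[of _ "sum \<mu> UNIV - \<epsilon>"] started_exp_cmult)
qed

lemma mean_net: "expectation (\<lambda>\<omega>. real (a k \<omega>) - tot (s k \<omega>)) = - \<epsilon>"
proof -
  have "expectation (\<lambda>\<omega>. real (a k \<omega>) - tot (s k \<omega>)) =
     expectation (\<lambda>\<omega>. real (a k \<omega>)) - (\<Sum>i\<in>UNIV. expectation (\<lambda>\<omega>. real (s k \<omega> $ i)))"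
    unfolding tot_def
    by (subst Bochner_Integration.integral_diff) (auto intro!: integrable_input[of "\<lambda>a s. real a"]
      integrable_input[of "\<lambda>a s. real (s $ _)"] Bochner_Integration.integrable_sum Bochner_Integration.integral_sum)
  then show ?thesis by (simp add: mean_arrival mean_service)
qed

lemma started_exp_tot_step:
  "started_exp m (Suc k) (\<lambda>x _ _ _. tot x)
    = started_exp m k (\<lambda>x _ _ _. tot x) - \<epsilon> * start_prob m + started_exp m k idle"
proof -
  (* The factor 1 turns the net input into a product with a function of the queue lengths. *)
  have "(\<lambda>(x::nat ^ 'n) y a s. tot y) = (\<lambda>x y a s. tot x + (1 * (real a - tot s) + idle x y a s))"
    by (simp add: idle_def fun_eq_iff)
  then show ?thesis
    using started_exp_indep[of m k "\<lambda>_. 1" "\<lambda>a s. real a - tot s"]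
    by (simp add: started_exp_Suc started_exp_add mean_net)
qed

end

section \<open>Moment recursions and capped limits\<close>
lemma weight_ge_1:
  fixes x :: "nat ^ 'n"
  assumes "0 \<le> \<kappa>" "\<kappa> * real CARD('n) \<le> 1"
  shows "1 \<le> weight \<kappa> x"
  using spread_nonneg[OF assms, of x] by (simp add: weight_def)

lemma weight_le_spread:
  fixes x :: "nat ^ 'n"
  assumes "0 \<le> \<kappa>" "\<kappa> * real CARD('n) \<le> 1"
  shows "weight \<kappa> x - 1 \<le> sqrt (spread \<kappa> x)"
  using sqrt_add_le_add_sqrt[of 1 "spread \<kappa> x"] spread_nonneg[OF assms, of x] by (simp add: weight_def)

lemma affine_recursion_sum_le:
  fixes y :: "nat \<Rightarrow> real"
  assumes step: "\<And>k. y (Suc k) \<le> (1 - r) * y k + C" and nn: "\<And>k. 0 \<le> y k"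
  shows "r * (\<Sum>k<T. y k) \<le> real T * C + y 0"
proof -
  have "r * (\<Sum>k<T. y k) \<le> real T * C + y 0 - y T"
  proof (induction T)
    case (Suc T)
    then show ?case using step[of T] by (simp add: algebra_simps)
  qed simp
  then show ?thesis using nn[of T] by simp
qed

lemma affine_recursion_le:
  fixes y :: "nat \<Rightarrow> real"
  assumes step: "\<And>k. y (Suc k) \<le> (1 - r) * y k + C" and r: "0 < r" "r \<le> 1" and "0 \<le> y 0" "0 \<le> C"
  shows "y k \<le> y 0 + C / r"
proof (induction k)
  case (Suc k)
  have "y (Suc k) \<le> (1 - r) * (y 0 + C / r) + C"
    using step[of k] Suc r by (smt (verit) mult_left_mono)
  also have "\<dots> = y 0 + C / r - r * y 0" using r by (simp add: field_simps)
  also have "\<dots> \<le> y 0 + C / r" using assms by simp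
  finally show ?case .
qed (use assms in simp)

text \<open>A form of Cesaro's argument: an estimate for partial sums that is linear in \<open>T\<close> up to a constant
  bounds the limit by its slope.\<close>
lemma limit_le_of_sum_le:
  fixes x :: "nat \<Rightarrow> real"
  assumes lim: "x \<longlonglongrightarrow> l" and sum: "\<And>T. (\<Sum>k<T. x k) \<le> b * real T + d"
  shows "l \<le> b"
proof (rule ccontr)
  assume "\<not> l \<le> b"
  define h where "h = (l + b) / 2"
  have h: "h < l" "b < h" using \<open>\<not> l \<le> b\<close> by (auto simp: h_def)
  obtain k0 where k0: "\<And>k. k \<ge> k0 \<Longrightarrow> h \<le> x k"
    using order_tendstoD(1)[OF lim h(1)] unfolding eventually_sequentially by (meson less_imp_le)
  have low: "(\<Sum>k<k0. x k) + real j * h \<le> (\<Sum>k<k0 + j. x k)" for j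
  proof (induction j)
    case (Suc j) then show ?case using k0[of "k0 + j"] by (simp add: algebra_simps)
  qed simp
  have "real j * (h - b) \<le> b * real k0 + d - (\<Sum>k<k0. x k)" for j
    using low[of j] sum[of "k0 + j"] by (simp add: algebra_simps)
  moreover obtain j where "b * real k0 + d - (\<Sum>k<k0. x k) < real j * (h - b)"
    using h reals_Archimedean3[of "h - b"] by auto
  ultimately show False by (meson not_less)
qed

lemma continuous_on_nat_vec:
  fixes f :: "nat ^ 'n \<Rightarrow> real"
  shows "continuous_on UNIV f"
proof -
  have "open S" for S :: "(nat ^ 'n) set"
  proof -
    have "\<exists>A. (\<forall>i. open (A i) \<and> x $ i \<in> A i) \<and> (\<forall>y. (\<forall>i. y $ i \<in> A i) \<longrightarrow> y \<in> S)" if "x \<in> S" for x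
      using that by (intro exI[of _ "\<lambda>i. {x $ i}"]) (simp add: Topological_Spaces.open_discrete flip: vec_eq_iff)
    then show ?thesis unfolding open_vec_def by blast
  qed
  then show ?thesis by (simp add: continuous_on_open_vimage)
qed

context bounded_jsq_system
begin

lemma exp_moment_step:
  fixes \<kappa> \<delta> \<theta> :: real
  defines "K \<equiv> real CARD('n) * (2 * real B)\<^sup>2"
    and "b \<equiv> real (CARD('n) + 1) * real B"
  assumes \<kappa>: "0 \<le> \<kappa>" "\<kappa> * real CARD('n) \<le> 1" and \<delta>: "0 < \<delta>"
    and drift: "\<And>x :: nat ^ 'n. push \<kappa> x (sum \<mu> UNIV - \<epsilon>) \<mu> \<le> - \<delta> * sqrt (spread \<kappa> x)"
    and \<theta>: "0 < \<theta>" "\<theta> * (b + K) \<le> 1" "\<theta> * (b + K)\<^sup>2 \<le> \<delta> / 4"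
  shows "started_exp m (Suc k) (\<lambda>x _ _ _. exp (\<theta> * weight \<kappa> x))
    \<le> (1 - \<theta> * \<delta> / 2) * started_exp m k (\<lambda>x _ _ _. exp (\<theta> * weight \<kappa> x))
      + \<theta> * (\<delta> + K) * exp (\<theta> * (4 * (\<delta> + K) / \<delta>))"
proof -
  let ?C = "\<theta> * (\<delta> + K) * exp (\<theta> * (4 * (\<delta> + K) / \<delta>))"
  let ?E = "\<lambda>x :: nat ^ 'n. exp (\<theta> * weight \<kappa> x)"
  let ?h = "\<lambda>x. \<theta> * (?E x / weight \<kappa> x)"
  let ?A = "\<lambda>x. ?E x * (1 + \<theta>\<^sup>2 * (b + K)\<^sup>2) + ?h x * (K / 2)"
  note W1 = weight_ge_1[OF \<kappa>]
  have K: "0 \<le> K" by (simp add: K_def)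
  have h: "0 \<le> ?h x" for x using \<theta> W1[of x] by simp
  have "started_exp m (Suc k) (\<lambda>x _ _ _. ?E x) = started_exp m k (\<lambda>_ y _ _. ?E y)"
    by (rule started_exp_Suc)
  also have "\<dots> \<le> started_exp m k (\<lambda>x y a s. ?A x + ?h x * push \<kappa> x (real a) (\<lambda>i. real (s $ i)))"
  proof (rule started_exp_mono)
    fix x y :: "nat ^ 'n" and a and s :: "nat ^ 'n" assume st: "jsq_step B x y a s"
    show "?E y \<le> ?A x + ?h x * push \<kappa> x (real a) (\<lambda>i. real (s $ i))"
      using exp_sqrt_step_le[OF spread_nonneg[OF \<kappa>] spread_nonneg[OF \<kappa>] spread_step_le[OF \<kappa> st]
          abs_push_le[OF \<kappa> st], folded K_def b_def weight_def, OF K less_imp_le[OF \<theta>(1)] \<theta>(2)]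
      by (simp add: algebra_simps)
  qed
  also have "\<dots> = started_exp m k (\<lambda>x y a s. ?A x + ?h x * push \<kappa> x (sum \<mu> UNIV - \<epsilon>) \<mu>)"
    by (simp only: started_exp_add started_exp_push)
  also have "\<dots> \<le> started_exp m k (\<lambda>x y a s. (1 - \<theta> * \<delta> / 2) * ?E x + ?C)"
  proof (rule started_exp_mono)
    fix x :: "nat ^ 'n"
    have "push \<kappa> x (sum \<mu> UNIV - \<epsilon>) \<mu> \<le> - \<delta> * (weight \<kappa> x - 1)"
      using drift[of x] mult_left_mono[OF weight_le_spread[OF \<kappa>, of x] less_imp_le[OF \<delta>]] by simp
    then have "?h x * push \<kappa> x (sum \<mu> UNIV - \<epsilon>) \<mu> \<le> ?h x * (- \<delta> * (weight \<kappa> x - 1))"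
      using h by (rule mult_left_mono)
    then show "?A x + ?h x * push \<kappa> x (sum \<mu> UNIV - \<epsilon>) \<mu> \<le> (1 - \<theta> * \<delta> / 2) * ?E x + ?C"
      using exp_drift_le[OF W1[of x] \<theta>(1,3) \<delta> K] unfolding distrib_left by linarith
  qed
  also have "\<dots> = (1 - \<theta> * \<delta> / 2) * started_exp m k (\<lambda>x _ _ _. ?E x) + ?C * start_prob m"
    by (simp only: started_exp_add started_exp_cmult started_exp_const)
  also have "\<dots> \<le> (1 - \<theta> * \<delta> / 2) * started_exp m k (\<lambda>x _ _ _. ?E x) + ?C"
    using start_prob_bounds(2)[of m] \<theta> \<delta> K by (intro add_left_mono mult_left_le) auto
  finally show ?thesis .
qed

text \<open>With \<open>d\<close> the net input, \<open>tot y = (tot x + d) + idle\<close>, and the terms that involve the idle service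
  are collected as \<open>2 tot y idle - idle\<^sup>2\<close> because \<open>tot y\<close>, unlike \<open>tot x\<close>, is small when servers
  idle.\<close>
lemma started_exp_tot_square_step:
  "started_exp m (Suc k) (\<lambda>x _ _ _. (tot x)\<^sup>2)
    = started_exp m k (\<lambda>x _ _ _. (tot x)\<^sup>2) - 2 * \<epsilon> * started_exp m k (\<lambda>x _ _ _. tot x)
      + (v + \<epsilon>\<^sup>2) * start_prob m
      + started_exp m k (\<lambda>x y a s. 2 * (tot y * idle x y a s) - (idle x y a s)\<^sup>2)"
proof -
  have net: "expectation (\<lambda>\<omega>. real (a k \<omega>) - tot (s k \<omega>)) = - \<epsilon>"
    by (rule mean_net)
  have "(\<lambda>(x::nat ^ 'n) y a s. (tot y)\<^sup>2) = (\<lambda>x y a s. (tot x)\<^sup>2 + (2 * (tot x * (real a - tot s))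
      + (1 * (real a - tot s)\<^sup>2 + (2 * (tot y * idle x y a s) - (idle x y a s)\<^sup>2))))"
    by (simp add: idle_def fun_eq_iff power2_eq_square algebra_simps)
  moreover have "started_exp m k (\<lambda>x _ a s. tot x * (real a - tot s)) = - (\<epsilon> * started_exp m k (\<lambda>x _ _ _. tot x))"
    using started_exp_indep[of m k tot "\<lambda>a s. real a - tot s"] by (simp add: net)
  moreover have "started_exp m k (\<lambda>x _ a s. 1 * (real a - tot s)\<^sup>2) = (v + \<epsilon>\<^sup>2) * start_prob m"
    using started_exp_indep[of m k "\<lambda>_. 1" "\<lambda>a s. (real a - tot s)\<^sup>2"] by (simp add: mean_net_square)
  ultimately show ?thesis
    by (simp only: started_exp_Suc started_exp_add started_exp_cmult)
qed

lemma start_prob_tendsto: "(\<lambda>m. start_prob (real m)) \<longlonglongrightarrow> 1"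
proof -
  have "(\<lambda>m. start_prob (real m)) \<longlonglongrightarrow> expectation (\<lambda>_. 1)"
    unfolding start_prob_def
  proof (rule integral_dominated_convergence[where w = "\<lambda>_. 1"])
    show "(\<lambda>\<omega>. of_bool (tot (q 0 \<omega>) \<le> real m) :: real) \<in> borel_measurable M" for m
      using integrable_started[of m "\<lambda>_ _ _ _. 1" 0] by (simp add: borel_measurable_integrable)
    show "AE \<omega> in M. (\<lambda>m. of_bool (tot (q 0 \<omega>) \<le> real m) :: real) \<longlonglongrightarrow> 1"
    proof (intro AE_I2 tendsto_eventually)
      fix \<omega>
      have "\<forall>m\<ge>nat \<lceil>tot (q 0 \<omega>)\<rceil>. tot (q 0 \<omega>) \<le> real m" by linarith
      then show "\<forall>\<^sub>F m in sequentially. of_bool (tot (q 0 \<omega>) \<le> real m) = (1 :: real)"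
        unfolding eventually_sequentially of_bool_eq_1_iff by blast
    qed
  qed auto
  then show ?thesis by (simp add: prob_space)
qed

lemma integrable_capped: "0 \<le> N \<Longrightarrow> integrable M (\<lambda>\<omega>. min (tot (q k \<omega>)) N)"
  by (intro integrable_const_bound[where B = N] borel_measurable_joint_fun[of "\<lambda>z x y a s. min (tot x) N" k])
    auto

text \<open>The next two lemmas link the restricted means to the capped means \<open>E (min (tot q) N)\<close>, whose
  limits are known from convergence in distribution.\<close>
lemma capped_le_started_exp:
  assumes N: "0 \<le> N"
  shows "expectation (\<lambda>\<omega>. min (tot (q k \<omega>)) N) \<le> started_exp m k (\<lambda>x _ _ _. tot x) + N * (1 - start_prob m)"
proof -
  let ?i = "\<lambda>\<omega>. of_bool (tot (q 0 \<omega>) \<le> m) :: real"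
  have i: "integrable M ?i" using integrable_started[of m "\<lambda>_ _ _ _. 1" 0] by simp
  have "expectation (\<lambda>\<omega>. min (tot (q k \<omega>)) N) \<le> expectation (\<lambda>\<omega>. ?i \<omega> * tot (q k \<omega>) + N * (1 - ?i \<omega>))"
    using N i by (intro integral_mono integrable_capped) auto
  also have "\<dots> = started_exp m k (\<lambda>x _ _ _. tot x) + N * (1 - start_prob m)"
    using i by (subst Bochner_Integration.integral_add) (auto simp: started_exp_def start_prob_def prob_space)
  finally show ?thesis .
qed

lemma started_exp_le_capped:
  assumes N: "0 < N"
  shows "started_exp m k (\<lambda>x _ _ _. tot x)
    \<le> expectation (\<lambda>\<omega>. min (tot (q k \<omega>)) N) + started_exp m k (\<lambda>x _ _ _. (tot x)\<^sup>2) / N"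
proof -
  let ?i = "\<lambda>\<omega>. of_bool (tot (q 0 \<omega>) \<le> m) :: real"
  have pt: "t \<le> min t N + t\<^sup>2 / N" if "0 \<le> t" for t
  proof (cases "t \<le> N")
    case False
    then have "t * N \<le> t * t" using that by (intro mult_left_mono) auto
    then have "t \<le> t\<^sup>2 / N" using N by (simp add: power2_eq_square field_simps)
    then show ?thesis using N False by simp
  qed (use N in simp)
  have "started_exp m k (\<lambda>x _ _ _. tot x)
      \<le> started_exp m k (\<lambda>x _ _ _. min (tot x) N) + started_exp m k (\<lambda>x _ _ _. (1 / N) * (tot x)\<^sup>2)"
    unfolding started_exp_add[symmetric] by (rule started_exp_mono) (use pt in auto)
  also have "started_exp m k (\<lambda>x _ _ _. min (tot x) N) \<le> expectation (\<lambda>\<omega>. min (tot (q k \<omega>)) N)"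
    unfolding started_exp_def using N
    by (intro integral_mono integrable_capped integrable_started) auto
  finally show ?thesis unfolding started_exp_cmult by simp
qed

end

section \<open>Balance equations summed over time\<close>

text \<open>The source of the logarithm: split at \<open>W = (2 / \<theta>) log (1 / \<epsilon>)\<close>. Below this level \<open>W\<close> is replaced by
  it. Above it, half of the exponent bounds \<open>W\<close>, and the other half supplies the factor \<open>\<epsilon>\<close>.\<close>
lemma mult_le_log_plus_exp:
  fixes W I b \<theta> \<epsilon> :: real
  assumes "0 \<le> W" "0 \<le> I" "I \<le> b" "0 < \<theta>" "0 < \<epsilon>" "\<epsilon> < 1"
  shows "W * I \<le> 2 / \<theta> * (ln (1 / \<epsilon>) * I + b * \<epsilon> * exp (\<theta> * W))"
proof (cases "\<theta> * W / 2 \<le> ln (1 / \<epsilon>)")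
  case True
  then have "W * I \<le> (2 / \<theta> * ln (1 / \<epsilon>)) * I"
    using assms by (intro mult_right_mono) (auto simp: field_simps)
  also have "\<dots> \<le> 2 / \<theta> * (ln (1 / \<epsilon>) * I + b * \<epsilon> * exp (\<theta> * W))"
    unfolding mult.assoc[of "2 / \<theta>"] using assms by (intro mult_left_mono) auto
  finally show ?thesis .
next
  case False
  have "1 / \<epsilon> \<le> exp (\<theta> * W / 2)"
    using False assms by (metis exp_le_cancel_iff exp_ln linear zero_less_divide_1_iff)
  then have "1 \<le> \<epsilon> * exp (\<theta> * W / 2)"
    using assms by (simp add: field_simps)
  then have "exp (\<theta> * W / 2) * 1 \<le> exp (\<theta> * W / 2) * (\<epsilon> * exp (\<theta> * W / 2))"
    by (intro mult_left_mono) auto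
  then have "exp (\<theta> * W / 2) \<le> \<epsilon> * exp (\<theta> * W)"
    by (simp add: mult.left_commute mult.commute[of W] flip: exp_add)
  moreover have "\<theta> * W / 2 \<le> exp (\<theta> * W / 2)"
    using exp_ge_add_one_self[of "\<theta> * W / 2"] by linarith
  ultimately have "W \<le> 2 / \<theta> * (\<epsilon> * exp (\<theta> * W))"
    using assms by (simp add: field_simps)
  then have "W * I \<le> 2 / \<theta> * (\<epsilon> * exp (\<theta> * W)) * b"
    using assms by (intro mult_mono) auto
  also have "\<dots> \<le> 2 / \<theta> * (ln (1 / \<epsilon>) * I + b * \<epsilon> * exp (\<theta> * W))"
    using assms by (simp add: distrib_left ac_simps)
  finally show ?thesis .
qed

lemma exists_small_rate:
  fixes c \<delta> :: real
  assumes "0 \<le> c" "0 < \<delta>"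
  obtains \<theta> where "0 < \<theta>" "\<theta> * c \<le> 1" "\<theta> * c\<^sup>2 \<le> \<delta> / 4" "\<theta> * \<delta> \<le> 1"
proof -
  have "\<exists>\<theta>>0. \<theta> * c \<le> 1 \<and> \<theta> * c\<^sup>2 \<le> \<delta> / 4 \<and> \<theta> * \<delta> \<le> 1"
  proof (intro exI[of _ "min (1 / (1 + c)) (min (\<delta> / (4 * (1 + c\<^sup>2))) (1 / \<delta>))"] conjI)
    let ?t = "min (1 / (1 + c)) (min (\<delta> / (4 * (1 + c\<^sup>2))) (1 / \<delta>))"
    have c2: "0 < 1 + c\<^sup>2" by (simp add: add_pos_nonneg)
    show "0 < ?t" using assms c2 by simp
    have "?t * c \<le> 1 / (1 + c) * c" using assms by (intro mult_right_mono) auto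
    also have "\<dots> \<le> 1" using assms by (simp add: field_simps)
    finally show "?t * c \<le> 1" .
    have "?t * c\<^sup>2 \<le> \<delta> / (4 * (1 + c\<^sup>2)) * c\<^sup>2" using assms by (intro mult_right_mono) auto
    also have "\<dots> \<le> \<delta> / 4" using assms c2 by (simp add: field_simps)
    finally show "?t * c\<^sup>2 \<le> \<delta> / 4" .
    have "?t * \<delta> \<le> 1 / \<delta> * \<delta>" using assms by (intro mult_right_mono) auto
    then show "?t * \<delta> \<le> 1" using assms by simp
  qed
  then show thesis using that by blast
qed

context bounded_jsq_system
begin

text \<open>The coefficient of \<open>T\<close> is free of \<open>m\<close>, \<open>\<epsilon>\<close> and the initial law; only \<open>d\<close> depends on these. Hence the
  effect of the start disappears from time averages.\<close>
lemma exp_moment_bounds: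
  fixes \<kappa> \<delta> \<theta> :: real
  defines "K \<equiv> real CARD('n) * (2 * real B)\<^sup>2"
    and "b \<equiv> real (CARD('n) + 1) * real B"
  assumes \<kappa>: "0 \<le> \<kappa>" "\<kappa> * real CARD('n) \<le> 1" and \<delta>: "0 < \<delta>"
    and drift: "\<And>x :: nat ^ 'n. push \<kappa> x (sum \<mu> UNIV - \<epsilon>) \<mu> \<le> - \<delta> * sqrt (spread \<kappa> x)"
    and \<theta>: "0 < \<theta>" "\<theta> * (b + K) \<le> 1" "\<theta> * (b + K)\<^sup>2 \<le> \<delta> / 4" "\<theta> * \<delta> \<le> 1"
  shows "\<exists>d. (\<forall>k. started_exp m k (\<lambda>x _ _ _. exp (\<theta> * weight \<kappa> x)) \<le> d) \<and>
    (\<forall>T. (\<Sum>k<T. started_exp m k (\<lambda>x _ _ _. exp (\<theta> * weight \<kappa> x)))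
       \<le> 2 * (\<delta> + K) / \<delta> * exp (\<theta> * (4 * (\<delta> + K) / \<delta>)) * real T + d)"
proof -
  define y where "y k = started_exp m k (\<lambda>x _ _ _. exp (\<theta> * weight \<kappa> x))" for k
  define C where "C = \<theta> * (\<delta> + K) * exp (\<theta> * (4 * (\<delta> + K) / \<delta>))"
  define r where "r = \<theta> * \<delta> / 2"
  have K: "0 \<le> K" by (simp add: K_def)
  have r: "0 < r" "r \<le> 1" using \<theta> \<delta> by (auto simp: r_def)
  have C: "0 \<le> C" using \<theta> \<delta> K by (simp add: C_def)
  have Cr: "C / r = 2 * (\<delta> + K) / \<delta> * exp (\<theta> * (4 * (\<delta> + K) / \<delta>))"
    using \<theta> \<delta> by (simp add: C_def r_def field_simps)
  have step: "y (Suc k) \<le> (1 - r) * y k + C" for k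
    unfolding y_def C_def r_def K_def
    by (rule exp_moment_step[OF \<kappa> \<delta> drift \<theta>(1) \<theta>(2,3)[unfolded b_def K_def]])
  have y0: "0 \<le> y k" for k
    unfolding y_def by (rule started_exp_nonneg) simp
  define d where "d = max (y 0 + C / r) (y 0 / r)"
  have "y k \<le> d" for k
    using affine_recursion_le[of y, OF step r y0 C, of k] by (simp add: d_def)
  moreover have "(\<Sum>k<T. y k) \<le> C / r * real T + d" for T
  proof -
    have "(\<Sum>k<T. y k) \<le> (real T * C + y 0) / r"
      using affine_recursion_sum_le[of y, OF step y0, of T] r by (simp add: pos_le_divide_eq mult.commute)
    also have "\<dots> = C / r * real T + y 0 / r" by (simp add: add_divide_distrib mult.commute)
    finally show ?thesis by (simp add: d_def)
  qed
  ultimately show ?thesis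
    unfolding y_def Cr by blast
qed

text \<open>The exponential drift for \<open>\<kappa> = 0\<close>. The bound \<open>d\<close> keeps the boundary terms of the summed balance
  equations bounded in \<open>T\<close>. The slope \<open>C\<close>, which depends on \<open>\<epsilon>\<close> but not on \<open>m\<close>, controls what is lost by
  capping the queue length at \<open>N\<close>.\<close>
lemma second_moment_bounds:
  assumes \<epsilon>: "0 < \<epsilon>" and \<mu>: "\<And>i. 0 < \<mu> i"
  shows "\<exists>C. \<forall>m. \<exists>d. (\<forall>k. started_exp m k (\<lambda>x _ _ _. (tot x)\<^sup>2) \<le> d) \<and>
    (\<forall>T. (\<Sum>k<T. started_exp m k (\<lambda>x _ _ _. (tot x)\<^sup>2)) \<le> C * real T + d)"
proof -
  define K where "K = real CARD('n) * (2 * real B)\<^sup>2"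
  define b where "b = real (CARD('n) + 1) * real B"
  (* \<epsilon> / n is the spare capacity when it is shared equally; no server can keep more than its rate. *)
  define \<delta> where "\<delta> = min (Min (range \<mu>)) (\<epsilon> / real CARD('n))"
  have "0 < Min (range \<mu>)" using \<mu> by (subst Min_gr_iff) auto
  then have \<delta>: "0 < \<delta>" using \<epsilon> by (simp add: \<delta>_def)
  have \<delta>\<mu>: "\<delta> \<le> \<mu> i" for i by (simp add: \<delta>_def min.coboundedI1)
  have \<delta>\<epsilon>: "\<delta> * real CARD('n) \<le> \<epsilon>"
  proof -
    have "\<delta> \<le> \<epsilon> / real CARD('n)" by (simp add: \<delta>_def)
    then show ?thesis by (simp add: field_simps)
  qed
  have "0 \<le> b + K" by (simp add: b_def K_def)
  then obtain \<theta> where \<theta>: "0 < \<theta>" "\<theta> * (b + K) \<le> 1" "\<theta> * (b + K)\<^sup>2 \<le> \<delta> / 4" "\<theta> * \<delta> \<le> 1"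
    using exists_small_rate \<delta> by blast
  define C where "C = 2 * (\<delta> + K) / \<delta> * exp (\<theta> * (4 * (\<delta> + K) / \<delta>))"
  define c where "c = real CARD('n) * (2 / \<theta>\<^sup>2)"
  have c: "0 \<le> c" by (simp add: c_def)
  have \<kappa>: "0 \<le> (0::real)" "0 * real CARD('n) \<le> 1" by auto
  have le: "started_exp m k (\<lambda>x _ _ _. (tot x)\<^sup>2) \<le> c * started_exp m k (\<lambda>x _ _ _. exp (\<theta> * weight 0 x))" for m k
    unfolding started_exp_cmult[symmetric]
  proof (rule started_exp_mono)
    fix x :: "nat ^ 'n"
    have "(tot x)\<^sup>2 \<le> real CARD('n) * (weight 0 x)\<^sup>2"
      using sum_sq_le_card[of "\<lambda>i. real (x $ i)"] spread_nonneg[OF \<kappa>, of x]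
      by (simp add: weight_def tot_def spread_def distrib_left)
    also have "(weight 0 x)\<^sup>2 \<le> 2 / \<theta>\<^sup>2 * exp (\<theta> * weight 0 x)"
    proof -
      have "0 \<le> \<theta> * weight 0 x" using weight_ge_1[OF \<kappa>, of x] \<theta> by simp
      then have "(\<theta> * weight 0 x)\<^sup>2 / 2 \<le> exp (\<theta> * weight 0 x)"
        using exp_lower_Taylor_quadratic[of "\<theta> * weight 0 x"] by linarith
      then show ?thesis using \<theta> by (simp add: field_simps power_mult_distrib)
    qed
    finally show "(tot x)\<^sup>2 \<le> c * exp (\<theta> * weight 0 x)"
      by (simp add: c_def)
  qed
  have "\<exists>d. (\<forall>k. started_exp m k (\<lambda>x _ _ _. (tot x)\<^sup>2) \<le> d) \<and>
    (\<forall>T. (\<Sum>k<T. started_exp m k (\<lambda>x _ _ _. (tot x)\<^sup>2)) \<le> c * C * real T + d)" for m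
  proof -
    obtain d where d: "\<And>k. started_exp m k (\<lambda>x _ _ _. exp (\<theta> * weight 0 x)) \<le> d"
      "\<And>T. (\<Sum>k<T. started_exp m k (\<lambda>x _ _ _. exp (\<theta> * weight 0 x))) \<le> C * real T + d"
      using exp_moment_bounds[OF \<kappa> \<delta> push_total_le[OF \<delta>\<mu> less_imp_le[OF \<delta>] \<delta>\<epsilon>] \<theta>(1)
          \<theta>(2,3)[unfolded b_def K_def] \<theta>(4), of m]
      unfolding C_def K_def by blast
    show ?thesis
    proof (intro exI[of _ "c * d"] conjI allI)
      show "started_exp m k (\<lambda>x _ _ _. (tot x)\<^sup>2) \<le> c * d" for k
        using le[of m k] mult_left_mono[OF d(1)[of k] c] by simp
      show "(\<Sum>k<T. started_exp m k (\<lambda>x _ _ _. (tot x)\<^sup>2)) \<le> c * C * real T + c * d" for T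
        using sum_mono[of "{..<T}", OF le[of m], of "\<lambda>k. k"] mult_left_mono[OF d(2)[of T] c]
        by (simp add: sum_distrib_left[symmetric] algebra_simps)
    qed
  qed
  then show ?thesis by blast
qed

text \<open>Averaged over time the unused service does not exceed the spare capacity \<open>\<epsilon>\<close>: any excess would
  accumulate in the mean total queue length, which stays bounded.\<close>
lemma idle_budget:
  assumes \<epsilon>: "0 < \<epsilon>" and d: "\<And>k. started_exp m k (\<lambda>x _ _ _. (tot x)\<^sup>2) \<le> d"
  shows "(\<Sum>k<T. started_exp m k idle) \<le> \<epsilon> * real T + (1 + d)"
proof -
  define e where "e k = started_exp m k (\<lambda>x _ _ _. tot x)" for k
  have "(\<Sum>k<T. started_exp m k idle) = \<epsilon> * start_prob m * real T + e T - e 0"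
    by (induction T) (auto simp: e_def started_exp_tot_step algebra_simps)
  moreover have "\<epsilon> * start_prob m * real T \<le> \<epsilon> * 1 * real T"
    using \<epsilon> start_prob_bounds[of m] by (intro mult_right_mono mult_left_mono) auto
  moreover have "0 \<le> e 0" unfolding e_def by (rule started_exp_nonneg) simp
  moreover have "e T \<le> 1 + d"
  proof -
    have "e T \<le> started_exp m T (\<lambda>x _ _ _. 1 + (tot x)\<^sup>2)"
      unfolding e_def
    proof (rule started_exp_mono)
      fix x :: "nat ^ 'n"
      have "0 \<le> (tot x - 1)\<^sup>2" by simp
      then show "tot x \<le> 1 + (tot x)\<^sup>2"
        using tot_nonneg[of x] by (simp add: power2_diff) (smt (verit) tot_nonneg)
    qed
    then show ?thesis
      using d[of T] start_prob_bounds(2)[of m] by (simp add: started_exp_add)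
  qed
  ultimately show ?thesis by simp
qed

lemma square_balance:
  "2 * \<epsilon> * (\<Sum>k<T. started_exp m k (\<lambda>x _ _ _. tot x))
    = (v + \<epsilon>\<^sup>2) * start_prob m * real T
      + (\<Sum>k<T. started_exp m k (\<lambda>x y a s. 2 * (tot y * idle x y a s) - (idle x y a s)\<^sup>2))
      + started_exp m 0 (\<lambda>x _ _ _. (tot x)\<^sup>2) - started_exp m T (\<lambda>x _ _ _. (tot x)\<^sup>2)"
  by (induction T) (auto simp: started_exp_tot_square_step algebra_simps)

text \<open>The upper estimate. The cross term \<open>2 tot y idle\<close> is at most \<open>2 n W idle\<close>; its split into
  \<open>log (1 / \<epsilon>) idle\<close> and \<open>\<epsilon> exp (\<theta> W)\<close> is summed with the idle budget and the exponential
  moments. Both contributions are of order \<open>\<epsilon>\<close> per slot, up to the logarithm, and survive the final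
  division by \<open>2 \<epsilon>\<close>.\<close>
lemma capped_limit_le:
  assumes \<epsilon>: "0 < \<epsilon>" "\<epsilon> < 1" and \<mu>: "\<And>i. 0 < \<mu> i" and \<theta>: "0 < \<theta>"
    and moment: "\<And>m. \<exists>d. \<forall>T. (\<Sum>k<T. started_exp m k
        (\<lambda>x _ _ _. exp (\<theta> * weight (1 / real CARD('n)) x))) \<le> C * real T + d"
    and N: "0 \<le> N" and lim: "(\<lambda>k. expectation (\<lambda>\<omega>. min (tot (q k \<omega>)) N)) \<longlonglongrightarrow> l"
  shows "l \<le> v / (2 * \<epsilon>) + \<epsilon> / 2 + 2 * real CARD('n) / \<theta> * (ln (1 / \<epsilon>) + real CARD('n) * real B * C)"
proof -
  define n where "n = real CARD('n)"
  define L where "L = ln (1 / \<epsilon>)"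
  define p where "p m = start_prob m" for m
  define R where "R = 4 * n / \<theta> * (L * \<epsilon> + n * real B * \<epsilon> * C)"
  have n: "0 < n" by (simp add: n_def)
  have L: "0 \<le> L" using \<epsilon> by (simp add: L_def)
  have bound: "l \<le> N * (1 - p m) + ((v + \<epsilon>\<^sup>2) * p m + R) / (2 * \<epsilon>)" for m
  proof -
    define e where "e k = started_exp m k (\<lambda>x _ _ _. tot x)" for k
    define w where "w k = started_exp m k idle" for k
    define y where "y k = started_exp m k (\<lambda>x _ _ _. exp (\<theta> * weight (1 / n) x))" for k
    define z where "z k = started_exp m k (\<lambda>x y a s. 2 * (tot y * idle x y a s) - (idle x y a s)\<^sup>2)" for k
    define x where "x k = expectation (\<lambda>\<omega>. min (tot (q k \<omega>)) N)" for k
    define Q where "Q k = started_exp m k (\<lambda>x _ _ _. (tot x)\<^sup>2)" for k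
    obtain d where d: "\<And>k. Q k \<le> d"
      using second_moment_bounds[OF \<epsilon>(1) \<mu>] unfolding Q_def by blast
    obtain d' where d': "\<And>T. (\<Sum>k<T. y k) \<le> C * real T + d'"
      using moment[of m] unfolding y_def n_def by blast
    have w: "(\<Sum>k<T. w k) \<le> \<epsilon> * real T + (1 + d)" for T
      unfolding w_def by (rule idle_budget[OF \<epsilon>(1) d[unfolded Q_def]])
    have zk: "z k \<le> 4 * n / \<theta> * (L * w k + n * real B * \<epsilon> * y (Suc k))" for k
    proof -
      have "z k \<le> started_exp m k (\<lambda>x y a s. 4 * n / \<theta> * (L * idle x y a s
          + n * real B * \<epsilon> * exp (\<theta> * weight (1 / n) y)))"
        unfolding z_def
      proof (rule started_exp_mono)
        fix x y :: "nat ^ 'n" and a s assume st: "jsq_step B x y a s"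
        let ?I = "idle x y a s"
        have "0 \<le> weight (1 / n) y" using weight_ge_1[of "1 / n" y] n by (simp add: n_def)
        then have "weight (1 / n) y * ?I \<le> 2 / \<theta> * (L * ?I + n * real B * \<epsilon> * exp (\<theta> * weight (1 / n) y))"
          unfolding L_def using idle_nonneg[OF st] idle_le[OF st] \<theta> \<epsilon>
          by (intro mult_le_log_plus_exp) (auto simp: n_def)
        have four: "n * (2 / \<theta> * t) * 2 = 4 * n / \<theta> * t" for t by simp
        from mult_left_mono[OF \<open>weight (1 / n) y * ?I \<le> _\<close>, of "2 * n"] n
        have "2 * (n * weight (1 / n) y * ?I) \<le> 4 * n / \<theta> * (L * ?I + n * real B * \<epsilon> * exp (\<theta> * weight (1 / n) y))"
          unfolding four[symmetric] by (simp only: ac_simps)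
        moreover have "tot y * ?I \<le> n * weight (1 / n) y * ?I"
          using tot_idle_le[OF st] by (simp add: n_def weight_def)
        moreover have "0 \<le> ?I\<^sup>2" by simp
        ultimately show "2 * (tot y * ?I) - ?I\<^sup>2
            \<le> 4 * n / \<theta> * (L * ?I + n * real B * \<epsilon> * exp (\<theta> * weight (1 / n) y))"
          by linarith
      qed
      also have "\<dots> = 4 * n / \<theta> * (L * w k + n * real B * \<epsilon> * y (Suc k))"
        unfolding started_exp_cmult started_exp_add w_def y_def started_exp_Suc ..
      finally show ?thesis .
    qed
    have z: "(\<Sum>k<T. z k) \<le> R * real T + 4 * n / \<theta> * (L * (1 + d) + n * real B * \<epsilon> * (C + d'))" for T
    proof -
      have "(\<Sum>k<T. y (Suc k)) \<le> (\<Sum>k<Suc T. y k)"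
        unfolding sum.lessThan_Suc_shift y_def by (simp add: started_exp_nonneg)
      also have "\<dots> \<le> C * real T + (C + d')" using d'[of "Suc T"] by (simp add: algebra_simps)
      finally have yS: "(\<Sum>k<T. y (Suc k)) \<le> C * real T + (C + d')" .
      have "(\<Sum>k<T. z k) \<le> 4 * n / \<theta> * (L * (\<Sum>k<T. w k) + n * real B * \<epsilon> * (\<Sum>k<T. y (Suc k)))"
        using sum_mono[of "{..<T}", OF zk] by (simp add: sum_distrib_left sum.distrib distrib_left)
      also have "\<dots> \<le> 4 * n / \<theta> * (L * (\<epsilon> * real T + (1 + d)) + n * real B * \<epsilon> * (C * real T + (C + d')))"
        using n \<theta> L \<epsilon> w yS by (intro mult_left_mono add_mono) auto
      finally show ?thesis by (simp add: R_def algebra_simps)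
    qed
    have "(\<Sum>k<T. x k) \<le> (N * (1 - p m) + ((v + \<epsilon>\<^sup>2) * p m + R) / (2 * \<epsilon>)) * real T
        + (4 * n / \<theta> * (L * (1 + d) + n * real B * \<epsilon> * (C + d')) + Q 0) / (2 * \<epsilon>)" for T
    proof -
      have "(\<Sum>k<T. x k) \<le> (\<Sum>k<T. e k) + N * (1 - p m) * real T"
        using sum_mono[of "{..<T}" x "\<lambda>k. e k + N * (1 - p m)"] capped_le_started_exp[OF N, of _ m]
        by (simp add: x_def e_def p_def sum.distrib mult.commute)
      moreover have "2 * \<epsilon> * (\<Sum>k<T. e k) \<le> ((v + \<epsilon>\<^sup>2) * p m + R) * real T
        + (4 * n / \<theta> * (L * (1 + d) + n * real B * \<epsilon> * (C + d')) + Q 0)"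
      proof -
        have "0 \<le> Q T" unfolding Q_def by (rule started_exp_nonneg) simp
        then show ?thesis
          using square_balance[of m T, folded e_def Q_def z_def p_def] z[of T]
          unfolding distrib_right by linarith
      qed
      then have "(\<Sum>k<T. e k) \<le> (((v + \<epsilon>\<^sup>2) * p m + R) * real T
        + (4 * n / \<theta> * (L * (1 + d) + n * real B * \<epsilon> * (C + d')) + Q 0)) / (2 * \<epsilon>)"
        using \<epsilon> by (simp add: pos_le_divide_eq mult.commute)
      ultimately show ?thesis
        unfolding distrib_right add_divide_distrib by (simp add: algebra_simps)
    qed
    with lim show ?thesis unfolding x_def by (rule limit_le_of_sum_le)
  qed
  have "l \<le> N * (1 - 1) + ((v + \<epsilon>\<^sup>2) * 1 + R) / (2 * \<epsilon>)"
  proof (rule LIMSEQ_le_const)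
    show "(\<lambda>m. N * (1 - p (real m)) + ((v + \<epsilon>\<^sup>2) * p (real m) + R) / (2 * \<epsilon>))
        \<longlonglongrightarrow> N * (1 - 1) + ((v + \<epsilon>\<^sup>2) * 1 + R) / (2 * \<epsilon>)"
      unfolding p_def using \<epsilon> by (intro tendsto_intros start_prob_tendsto) auto
  qed (use bound in blast)
  also have "\<dots> = v / (2 * \<epsilon>) + \<epsilon> / 2 + 2 * n / \<theta> * (L + n * real B * C)"
    using \<epsilon> \<theta> by (simp add: R_def field_simps power2_eq_square)
  finally show ?thesis by (simp add: n_def L_def)
qed

text \<open>The lower estimate drops the cross term, which is nonnegative, and keeps only
  \<open>idle\<^sup>2 \<le> n B idle\<close>, whose time average is at most \<open>n B \<epsilon>\<close>.\<close>
lemma capped_limit_ge: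
  assumes \<epsilon>: "0 < \<epsilon>" and C: "\<And>m. \<exists>d. (\<forall>k. started_exp m k (\<lambda>x _ _ _. (tot x)\<^sup>2) \<le> d) \<and>
    (\<forall>T. (\<Sum>k<T. started_exp m k (\<lambda>x _ _ _. (tot x)\<^sup>2)) \<le> C * real T + d)"
    and N: "0 < N" and lim: "(\<lambda>k. expectation (\<lambda>\<omega>. min (tot (q k \<omega>)) N)) \<longlonglongrightarrow> l"
  shows "v / (2 * \<epsilon>) - real CARD('n) * real B / 2 - C / N \<le> l"
proof -
  define n where "n = real CARD('n)"
  define p where "p m = start_prob m" for m
  have n: "0 < n" by (simp add: n_def)
  have bound: "((v + \<epsilon>\<^sup>2) * p m - n * real B * \<epsilon>) / (2 * \<epsilon>) - C / N \<le> l" for m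
  proof -
    define e where "e k = started_exp m k (\<lambda>x _ _ _. tot x)" for k
    define w where "w k = started_exp m k idle" for k
    define z where "z k = started_exp m k (\<lambda>x y a s. 2 * (tot y * idle x y a s) - (idle x y a s)\<^sup>2)" for k
    define x where "x k = expectation (\<lambda>\<omega>. min (tot (q k \<omega>)) N)" for k
    define Q where "Q k = started_exp m k (\<lambda>x _ _ _. (tot x)\<^sup>2)" for k
    obtain d where d: "\<And>k. Q k \<le> d" and d': "\<And>T. (\<Sum>k<T. Q k) \<le> C * real T + d"
      using C[of m] unfolding Q_def by blast
    have w: "(\<Sum>k<T. w k) \<le> \<epsilon> * real T + (1 + d)" for T
      unfolding w_def by (rule idle_budget[OF \<epsilon> d[unfolded Q_def]])
    have zk: "- (n * real B) * w k \<le> z k" for k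
      unfolding w_def z_def started_exp_cmult[symmetric]
    proof (rule started_exp_mono)
      fix x y :: "nat ^ 'n" and a s assume st: "jsq_step B x y a s"
      have "idle x y a s * idle x y a s \<le> n * real B * idle x y a s"
        using idle_le[OF st] idle_nonneg[OF st] unfolding n_def by (intro mult_right_mono)
      moreover have "0 \<le> tot y * idle x y a s"
        using idle_nonneg[OF st] by simp
      ultimately show "- (n * real B) * idle x y a s \<le> 2 * (tot y * idle x y a s) - (idle x y a s)\<^sup>2"
        by (simp add: power2_eq_square)
    qed
    have z: "- (n * real B * (\<epsilon> * real T + (1 + d))) \<le> (\<Sum>k<T. z k)" for T
    proof -
      have "- (n * real B) * (\<epsilon> * real T + (1 + d)) \<le> - (n * real B) * (\<Sum>k<T. w k)"
        using w[of T] n by (intro mult_left_mono_neg) auto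
      also have "\<dots> \<le> (\<Sum>k<T. z k)"
        using sum_mono[of "{..<T}", OF zk] by (simp add: sum_distrib_left)
      finally show ?thesis by simp
    qed
    have "(\<Sum>k<T. - x k) \<le> - (((v + \<epsilon>\<^sup>2) * p m - n * real B * \<epsilon>) / (2 * \<epsilon>) - C / N) * real T
        + ((n * real B * (1 + d) + d) / (2 * \<epsilon>) + d / N)" for T
    proof -
      have "(\<Sum>k<T. e k) \<le> (\<Sum>k<T. x k) + (\<Sum>k<T. Q k) / N"
        using sum_mono[of "{..<T}" e "\<lambda>k. x k + Q k / N"] started_exp_le_capped[OF N, of m]
        by (simp add: x_def e_def Q_def sum.distrib sum_divide_distrib)
      also have "\<dots> \<le> (\<Sum>k<T. x k) + (C * real T + d) / N"
        using d'[of T] N by (simp add: divide_right_mono)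
      finally have 1: "(\<Sum>k<T. e k) \<le> (\<Sum>k<T. x k) + (C * real T + d) / N" .
      have "0 \<le> Q 0" unfolding Q_def by (rule started_exp_nonneg) simp
      then have "(v + \<epsilon>\<^sup>2) * p m * real T - n * real B * (\<epsilon> * real T + (1 + d)) - d \<le> 2 * \<epsilon> * (\<Sum>k<T. e k)"
        using square_balance[of m T, folded e_def Q_def z_def p_def] z[of T] d[of T] by linarith
      then have "((v + \<epsilon>\<^sup>2) * p m * real T - n * real B * (\<epsilon> * real T + (1 + d)) - d) / (2 * \<epsilon>) \<le> (\<Sum>k<T. e k)"
        using \<epsilon> by (simp add: pos_divide_le_eq mult.commute)
      moreover have "((v + \<epsilon>\<^sup>2) * p m * real T - n * real B * (\<epsilon> * real T + (1 + d)) - d) / (2 * \<epsilon>)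
        = ((v + \<epsilon>\<^sup>2) * p m - n * real B * \<epsilon>) / (2 * \<epsilon>) * real T - (n * real B * (1 + d) + d) / (2 * \<epsilon>)"
        using \<epsilon> by (simp add: field_simps)
      moreover have "(C * real T + d) / N = C / N * real T + d / N" by (simp add: add_divide_distrib)
      ultimately show ?thesis
        using 1 by (simp add: sum_negf algebra_simps)
    qed
    with tendsto_minus[OF lim] have "- l \<le> - (((v + \<epsilon>\<^sup>2) * p m - n * real B * \<epsilon>) / (2 * \<epsilon>) - C / N)"
      unfolding x_def by (rule limit_le_of_sum_le)
    then show ?thesis by simp
  qed
  have "((v + \<epsilon>\<^sup>2) * 1 - n * real B * \<epsilon>) / (2 * \<epsilon>) - C / N \<le> l"
  proof (rule LIMSEQ_le_const2)
    show "(\<lambda>m. ((v + \<epsilon>\<^sup>2) * p (real m) - n * real B * \<epsilon>) / (2 * \<epsilon>) - C / N)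
        \<longlonglongrightarrow> ((v + \<epsilon>\<^sup>2) * 1 - n * real B * \<epsilon>) / (2 * \<epsilon>) - C / N"
      unfolding p_def using \<epsilon> by (intro tendsto_intros start_prob_tendsto) auto
  qed (use bound in blast)
  moreover have "((v + \<epsilon>\<^sup>2) * 1 - n * real B * \<epsilon>) / (2 * \<epsilon>) = v / (2 * \<epsilon>) + \<epsilon> / 2 - n * real B / 2"
    using \<epsilon> by (simp add: field_simps power2_eq_square)
  ultimately show ?thesis using \<epsilon> by (simp add: n_def)
qed

lemma steady_state_mean:
  fixes qbar :: "(nat ^ 'n) pmf"
  assumes \<epsilon>: "0 < \<epsilon>" "\<epsilon> < 1" and \<mu>: "\<And>i. 0 < \<mu> i" and \<theta>: "0 < \<theta>" and C: "0 \<le> C"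
    and moment: "\<And>m. \<exists>d. \<forall>T. (\<Sum>k<T. started_exp m k
        (\<lambda>x _ _ _. exp (\<theta> * weight (1 / real CARD('n)) x))) \<le> C * real T + d"
    and steady: "converges_in_distribution M q (measure_pmf qbar)"
  shows "integrable (measure_pmf qbar) tot"
    and "\<bar>measure_pmf.expectation qbar tot - v / (2 * \<epsilon>)\<bar>
      \<le> \<epsilon> / 2 + 2 * real CARD('n) / \<theta> * (ln (1 / \<epsilon>) + real CARD('n) * real B * C) + real CARD('n) * real B / 2"
proof -
  define U where "U = v / (2 * \<epsilon>) + \<epsilon> / 2 + 2 * real CARD('n) / \<theta> * (ln (1 / \<epsilon>) + real CARD('n) * real B * C)"
  define l where "l N = measure_pmf.expectation qbar (\<lambda>x. min (tot x) (real N))" for N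
  have lim: "(\<lambda>k. expectation (\<lambda>\<omega>. min (tot (q k \<omega>)) (real N))) \<longlonglongrightarrow> l N" for N
  proof -
    have "bounded (range (\<lambda>x :: nat ^ 'n. min (tot x) (real N)))"
      by (rule boundedI[where B = "real N"]) auto
    then show ?thesis
      using steady continuous_on_nat_vec unfolding converges_in_distribution_def l_def by blast
  qed
  have int: "integrable (measure_pmf qbar) (\<lambda>x. min (tot x) (real N))" for N
    by (rule measure_pmf.integrable_const_bound[where B = "real N"]) auto
  have up: "l N \<le> U" for N
    unfolding U_def by (rule capped_limit_le[OF \<epsilon> \<mu> \<theta> moment _ lim]) simp_all
  have mono: "incseq l"
    unfolding l_def incseq_def by (intro allI impI integral_mono int) auto
  obtain L where L: "l \<longlonglongrightarrow> L" using incseq_convergent[OF mono, of U] up by blast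
  have conv: "(\<lambda>N. min (tot x) (real N)) \<longlonglongrightarrow> tot x" for x :: "nat ^ 'n"
  proof (intro tendsto_eventually)
    have "\<forall>N\<ge>nat \<lceil>tot x\<rceil>. tot x \<le> real N" by linarith
    then show "\<forall>\<^sub>F N in sequentially. min (tot x) (real N) = tot x"
      unfolding eventually_sequentially by (meson min.absorb1)
  qed
  have "has_bochner_integral (measure_pmf qbar) tot L"
    by (rule has_bochner_integral_monotone_convergence[OF int _ _ L[unfolded l_def]])
      (auto simp: mono_def conv)
  then have tot: "integrable (measure_pmf qbar) tot" "measure_pmf.expectation qbar tot = L"
    by (auto simp: has_bochner_integral_iff)
  show "integrable (measure_pmf qbar) tot" by fact
  obtain C2 where C2: "\<And>m. \<exists>d. (\<forall>k. started_exp m k (\<lambda>x _ _ _. (tot x)\<^sup>2) \<le> d) \<and>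
    (\<forall>T. (\<Sum>k<T. started_exp m k (\<lambda>x _ _ _. (tot x)\<^sup>2)) \<le> C2 * real T + d)"
    using second_moment_bounds[OF \<epsilon>(1) \<mu>] by blast
  have "L \<le> U" using L up by (intro LIMSEQ_le_const2) auto
  moreover have "v / (2 * \<epsilon>) - real CARD('n) * real B / 2 - 0 \<le> L"
  proof (rule LIMSEQ_le[OF _ L])
    show "(\<lambda>N. v / (2 * \<epsilon>) - real CARD('n) * real B / 2 - C2 / real N)
        \<longlonglongrightarrow> v / (2 * \<epsilon>) - real CARD('n) * real B / 2 - 0"
      by (intro tendsto_intros lim_const_over_n)
    show "\<exists>n0. \<forall>N\<ge>n0. v / (2 * \<epsilon>) - real CARD('n) * real B / 2 - C2 / real N \<le> l N"
      using capped_limit_ge[OF \<epsilon>(1) C2 _ lim] by (intro exI[of _ 1]) auto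
  qed
  moreover have "0 \<le> 2 * real CARD('n) / \<theta> * (ln (1 / \<epsilon>) + real CARD('n) * real B * C)"
    using \<theta> \<epsilon> C by simp
  ultimately show "\<bar>measure_pmf.expectation qbar tot - v / (2 * \<epsilon>)\<bar>
      \<le> \<epsilon> / 2 + 2 * real CARD('n) / \<theta> * (ln (1 / \<epsilon>) + real CARD('n) * real B * C) + real CARD('n) * real B / 2"
    using \<epsilon> zero_le_mult_iff[of "real CARD('n)" "real B"]
    unfolding tot(2) U_def by (intro abs_leI) linarith+
qed

end

section \<open>From the given laws to the balance constants\<close>
lemma integrable_service_product:
  fixes S :: "(nat ^ 'n) pmf"
  assumes "\<And>i. AE x in measure_pmf S. x $ i \<le> B"
  shows "integrable (measure_pmf S) (\<lambda>x. real (x $ i) * real (x $ j))"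
proof (rule measure_pmf.integrable_const_bound[where B = "real B * real B"])
  show "AE x in measure_pmf S. norm (real (x $ i) * real (x $ j)) \<le> real B * real B"
    using assms[of i] assms[of j] by eventually_elim (auto intro: mult_mono)
qed simp

lemma integrable_service:
  fixes S :: "(nat ^ 'n) pmf"
  assumes "\<And>i. AE x in measure_pmf S. x $ i \<le> B"
  shows "integrable (measure_pmf S) (\<lambda>x. real (x $ i))"
proof (rule measure_pmf.integrable_const_bound[where B = "real B"])
  show "AE x in measure_pmf S. norm (real (x $ i)) \<le> real B"
    using assms[of i] by eventually_elim auto
qed simp

lemma expectation_tot_service:
  fixes S :: "(nat ^ 'n) pmf"
  assumes "\<And>i. AE x in measure_pmf S. x $ i \<le> B"
  shows "measure_pmf.expectation S tot = total_service_rate S"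
  unfolding tot_def total_service_rate_def service_mean_def
  by (rule Bochner_Integration.integral_sum) (rule integrable_service[OF assms])

lemma expectation_tot_service_square:
  fixes S :: "(nat ^ 'n) pmf"
  assumes B: "\<And>i. AE x in measure_pmf S. x $ i \<le> B"
    and unc: "\<And>i j. i \<noteq> j \<Longrightarrow>
      measure_pmf.expectation S (\<lambda>x. real (x $ i) * real (x $ j)) = service_mean S i * service_mean S j"
  shows "measure_pmf.expectation S (\<lambda>x. (tot x)\<^sup>2) = (total_service_rate S)\<^sup>2 + (\<Sum>i\<in>UNIV. service_var S i)"
proof -
  note int = integrable_service_product[OF B]
  have diag: "measure_pmf.expectation S (\<lambda>x. real (x $ i) * real (x $ i)) = (service_mean S i)\<^sup>2 + service_var S i" for i
    unfolding service_var_def service_mean_def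
    using measure_pmf.variance_eq[of S "\<lambda>x. real (x $ i)"] int[of i i] integrable_service[OF B, of i]
    by (simp add: power2_eq_square)
  have "measure_pmf.expectation S (\<lambda>x. (tot x)\<^sup>2)
      = (\<Sum>i\<in>UNIV. \<Sum>j\<in>UNIV. measure_pmf.expectation S (\<lambda>x. real (x $ i) * real (x $ j)))"
    unfolding tot_def power2_eq_square sum_product
    by (simp add: int Bochner_Integration.integral_sum)
  also have "\<dots> = (\<Sum>i\<in>UNIV. \<Sum>j\<in>UNIV. service_mean S i * service_mean S j + (if j = i then service_var S i else 0))"
    using diag unc by (intro sum.cong refl) (auto simp: power2_eq_square)
  also have "\<dots> = (total_service_rate S)\<^sup>2 + (\<Sum>i\<in>UNIV. service_var S i)"
    by (simp add: sum.distrib total_service_rate_def power2_eq_square sum_product)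
  finally show ?thesis .
qed

context jsq_system
begin

lemma measurable_arrival: "a k \<in> measurable M (count_space UNIV)"
  using arrivals_indep by (simp add: indep_vars_def2)

lemma measurable_service: "s k \<in> measurable M (count_space UNIV)"
  using services_indep by (simp add: indep_vars_def2)

lemma expectation_arrival_eq:
  fixes f :: "nat \<Rightarrow> real"
  shows "expectation (\<lambda>\<omega>. f (a k \<omega>)) = expectation (\<lambda>\<omega>. f (a 1 \<omega>))"
  using integral_distr[OF measurable_arrival, of f k] integral_distr[OF measurable_arrival, of f 1]
    arrivals_ident[of k] by simp

lemma expectation_service_eq:
  fixes f :: "nat ^ 'n \<Rightarrow> real"
  assumes "distr M (count_space UNIV) (s 1) = measure_pmf S"
  shows "expectation (\<lambda>\<omega>. f (s k \<omega>)) = measure_pmf.expectation S f"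
  using integral_distr[OF measurable_service, of f k] services_ident[of k] assms by simp

lemma integrable_service_eq:
  fixes f :: "nat ^ 'n \<Rightarrow> real"
  assumes "distr M (count_space UNIV) (s 1) = measure_pmf S" "integrable (measure_pmf S) f"
  shows "integrable M (\<lambda>\<omega>. f (s k \<omega>))"
  using integrable_distr_eq[OF measurable_service, of f k] services_ident[of k] assms by simp

lemma AE_arrival:
  assumes "AE \<omega> in M. P (a 1 \<omega>)" shows "AE \<omega> in M. P (a k \<omega>)"
  using AE_distr_iff[OF measurable_arrival, of P k] AE_distr_iff[OF measurable_arrival, of P 1]
    arrivals_ident[of k] assms by (metis (no_types, lifting) UNIV_I sets_count_space Pow_UNIV space_count_space)

lemma AE_service:
  assumes "distr M (count_space UNIV) (s 1) = measure_pmf S" "AE x in measure_pmf S. P x"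
  shows "AE \<omega> in M. P (s k \<omega>)"
  using AE_distr_iff[OF measurable_service, of P k] services_ident[of k] assms
  by (metis (no_types, lifting) UNIV_I sets_count_space Pow_UNIV space_count_space)

lemma expectation_arrival_service:
  fixes f :: "nat \<Rightarrow> real" and g :: "nat ^ 'n \<Rightarrow> real"
  assumes "integrable M (\<lambda>\<omega>. f (a k \<omega>))" "integrable M (\<lambda>\<omega>. g (s k \<omega>))"
  shows "integrable M (\<lambda>\<omega>. f (a k \<omega>) * g (s k \<omega>))"
    and "expectation (\<lambda>\<omega>. f (a k \<omega>) * g (s k \<omega>))
      = expectation (\<lambda>\<omega>. f (a k \<omega>)) * expectation (\<lambda>\<omega>. g (s k \<omega>))"
proof -
  have proj: "(\<lambda>x. h (x k)) \<in> borel_measurable (\<Pi>\<^sub>M k\<in>UNIV. count_space UNIV)" for h :: "'z \<Rightarrow> real"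
    by (rule measurable_compose[OF measurable_component_singleton]) auto
  have "indep_var borel (\<lambda>\<omega>. f (a k \<omega>)) borel (\<lambda>\<omega>. g (s k \<omega>))"
    using indep_rvs_compose[OF arrivals_services_indep proj[of f] proj[of g]]
    by (simp add: indep_rvs_eq_indep_var)
  from indep_var_integrable[OF this assms] indep_var_lebesgue_integral[OF this assms]
  show "integrable M (\<lambda>\<omega>. f (a k \<omega>) * g (s k \<omega>))"
    "expectation (\<lambda>\<omega>. f (a k \<omega>) * g (s k \<omega>))
      = expectation (\<lambda>\<omega>. f (a k \<omega>)) * expectation (\<lambda>\<omega>. g (s k \<omega>))" .
qed

text \<open>Arrivals and services of a slot are independent, and services are uncorrelated across
  servers, so the second moment of \<open>A - \<Sigma>\<close> is the sum of all variances plus the square of its mean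
  \<open>- \<epsilon>\<close>.\<close>
lemma bounded_jsq_systemI:
  fixes S :: "(nat ^ 'n) pmf"
  assumes law: "distr M (count_space UNIV) (s 1) = measure_pmf S"
    and S: "\<And>i. AE x in measure_pmf S. x $ i \<le> B"
    and unc: "\<And>i j. i \<noteq> j \<Longrightarrow>
      measure_pmf.expectation S (\<lambda>x. real (x $ i) * real (x $ j)) = service_mean S i * service_mean S j"
    and A: "AE \<omega> in M. a 1 \<omega> \<le> B"
    and rate: "expectation (\<lambda>\<omega>. real (a 1 \<omega>)) = total_service_rate S - \<epsilon>"
  shows "bounded_jsq_system M a s av u q B (service_mean S) \<epsilon>
    (variance (\<lambda>\<omega>. real (a 1 \<omega>)) + (\<Sum>i\<in>UNIV. service_var S i))"
proof -
  note arrivals_le = AE_arrival[OF A]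
  have mean: "expectation (\<lambda>\<omega>. real (a k \<omega>)) = total_service_rate S - \<epsilon>" for k
    using expectation_arrival_eq[of real k] rate by simp
  have ia: "integrable M (\<lambda>\<omega>. real (a k \<omega>))" for k
    using arrivals_le[of k] measurable_compose[OF measurable_arrival, of real borel k]
    by (intro integrable_const_bound[where B = "real B"]) auto
  have ia2: "integrable M (\<lambda>\<omega>. (real (a k \<omega>))\<^sup>2)" for k
    using arrivals_le[of k] measurable_compose[OF measurable_arrival, of "\<lambda>n. (real n)\<^sup>2" borel k]
    by (intro integrable_const_bound[where B = "(real B)\<^sup>2"]) (auto simp: power_mono)
  have S1: "integrable (measure_pmf S) tot"
    unfolding tot_def by (intro Bochner_Integration.integrable_sum integrable_service[OF S])
  have S2: "integrable (measure_pmf S) (\<lambda>x. (tot x)\<^sup>2)"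
    unfolding tot_def power2_eq_square sum_product
    by (intro Bochner_Integration.integrable_sum integrable_service_product[OF S])
  have "expectation (\<lambda>\<omega>. (real (a k \<omega>) - tot (s k \<omega>))\<^sup>2)
    = variance (\<lambda>\<omega>. real (a 1 \<omega>)) + (\<Sum>i\<in>UNIV. service_var S i) + \<epsilon>\<^sup>2" for k
  proof -
    have is1: "integrable M (\<lambda>\<omega>. tot (s k \<omega>))" and is2: "integrable M (\<lambda>\<omega>. (tot (s k \<omega>))\<^sup>2)"
      using integrable_service_eq[OF law S1] integrable_service_eq[OF law S2] by auto
    have "expectation (\<lambda>\<omega>. (real (a k \<omega>) - tot (s k \<omega>))\<^sup>2)
      = expectation (\<lambda>\<omega>. (real (a k \<omega>))\<^sup>2 + (tot (s k \<omega>))\<^sup>2 - 2 * (real (a k \<omega>) * tot (s k \<omega>)))"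
      by (simp add: power2_diff mult.assoc)
    also have "\<dots> = expectation (\<lambda>\<omega>. (real (a k \<omega>))\<^sup>2) + expectation (\<lambda>\<omega>. (tot (s k \<omega>))\<^sup>2)
        - 2 * expectation (\<lambda>\<omega>. real (a k \<omega>) * tot (s k \<omega>))"
      using expectation_arrival_service(1)[OF ia is1] ia2 is2 by simp
    also have "expectation (\<lambda>\<omega>. real (a k \<omega>) * tot (s k \<omega>)) = (total_service_rate S - \<epsilon>) * total_service_rate S"
      using expectation_arrival_service(2)[OF ia is1] mean[of k]
        expectation_service_eq[OF law, of tot k] expectation_tot_service[OF S] by simp
    also have "expectation (\<lambda>\<omega>. (tot (s k \<omega>))\<^sup>2) = (total_service_rate S)\<^sup>2 + (\<Sum>i\<in>UNIV. service_var S i)"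
      using expectation_service_eq[OF law, of "\<lambda>x. (tot x)\<^sup>2" k] expectation_tot_service_square[OF S unc] by simp
    also have "expectation (\<lambda>\<omega>. (real (a k \<omega>))\<^sup>2) = variance (\<lambda>\<omega>. real (a 1 \<omega>)) + (total_service_rate S - \<epsilon>)\<^sup>2"
      using variance_eq[OF ia ia2, of 1] expectation_arrival_eq[of "\<lambda>n. (real n)\<^sup>2" k] rate by simp
    finally show ?thesis by (simp add: power2_eq_square algebra_simps)
  qed
  moreover have "expectation (\<lambda>\<omega>. real (s k \<omega> $ i)) = service_mean S i" for k i
    using expectation_service_eq[OF law, of "\<lambda>x. real (x $ i)" k] by (simp add: service_mean_def)
  ultimately show ?thesis
    using arrivals_le AE_service[OF law S] mean
    by unfold_locales (auto simp: total_service_rate_def)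
qed

end

section \<open>The heavy traffic bound\<close>
theorem theorem2:
  fixes S :: "(nat ^ 'n) pmf"
    and M :: "real \<Rightarrow> 'w measure"
    and a :: "real \<Rightarrow> nat \<Rightarrow> 'w \<Rightarrow> nat"
    and s av u q :: "real \<Rightarrow> nat \<Rightarrow> 'w \<Rightarrow> nat ^ 'n"
    and qbar :: "real \<Rightarrow> (nat ^ 'n) pmf"
    and A_max S_max :: real
  assumes service_bounded: "\<And>i. AE x in measure_pmf S. real (x $ i) \<le> S_max"
    and service_pos: "\<And>i. service_mean S i > 0"
    and service_uncorrelated: "\<And>i j. i \<noteq> j \<Longrightarrow>
      measure_pmf.expectation S (\<lambda>x. real (x $ i) * real (x $ j)) = service_mean S i * service_mean S j"
    and system: "\<And>\<epsilon>. \<epsilon> \<in> {0<..<total_service_rate S} \<Longrightarrow>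
      jsq_system (M \<epsilon>) (a \<epsilon>) (s \<epsilon>) (av \<epsilon>) (u \<epsilon>) (q \<epsilon>)"
    and service_law: "\<And>\<epsilon>. \<epsilon> \<in> {0<..<total_service_rate S} \<Longrightarrow>
      distr (M \<epsilon>) (count_space UNIV) (s \<epsilon> 1) = measure_pmf S"
    and arrival_bounded: "\<And>\<epsilon>. \<epsilon> \<in> {0<..<total_service_rate S} \<Longrightarrow>
      AE \<omega> in M \<epsilon>. real (a \<epsilon> 1 \<omega>) \<le> A_max"
    and arrival_rate: "\<And>\<epsilon>. \<epsilon> \<in> {0<..<total_service_rate S} \<Longrightarrow>
      prob_space.expectation (M \<epsilon>) (\<lambda>\<omega>. real (a \<epsilon> 1 \<omega>)) = total_service_rate S - \<epsilon>"
    and steady_state: "\<And>\<epsilon>. \<epsilon> \<in> {0<..<total_service_rate S} \<Longrightarrow>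
      converges_in_distribution (M \<epsilon>) (q \<epsilon>) (measure_pmf (qbar \<epsilon>))"
  shows "\<exists>\<beta>_JSQ. \<exists>\<epsilon>\<^sub>0 \<in> {0<..<total_service_rate S}. \<forall>\<epsilon> \<in> {0<..<\<epsilon>\<^sub>0}.
      integrable (measure_pmf (qbar \<epsilon>)) (\<lambda>x. \<Sum>i\<in>UNIV. real (x $ i)) \<and>
      \<bar>measure_pmf.expectation (qbar \<epsilon>) (\<lambda>x. \<Sum>i\<in>UNIV. real (x $ i))
         - 1 / (2 * \<epsilon>) * (prob_space.variance (M \<epsilon>) (\<lambda>\<omega>. real (a \<epsilon> 1 \<omega>))
                         + (\<Sum>i\<in>UNIV. service_var S i))\<bar>
        \<le> \<beta>_JSQ * ln (1 / \<epsilon>)"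
proof -
  define n where "n = real CARD('n)"
  (* One integer bounds the arrivals and all services. *)
  define B where "B = nat \<lceil>max A_max S_max\<rceil>"
  define \<mu> where "\<mu> = Min (range (service_mean S))"
  define \<delta> where "\<delta> = \<mu> / 2"
  define K where "K = n * (2 * real B)\<^sup>2"
  define b where "b = real (CARD('n) + 1) * real B"
  have n: "0 < n" by (simp add: n_def)
  have "0 < \<mu>" unfolding \<mu>_def using service_pos by (subst Min_gr_iff) auto
  then have \<delta>: "0 < \<delta>" by (simp add: \<delta>_def)
  have \<mu>: "\<mu> \<le> service_mean S i" for i by (simp add: \<mu>_def)
  have total: "0 < total_service_rate S"
    unfolding total_service_rate_def using service_pos by (intro sum_pos) auto
  have K: "0 \<le> K" using n by (simp add: K_def)
  then have "0 \<le> b + K" by (simp add: b_def)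
  then obtain \<theta> where \<theta>: "0 < \<theta>" "\<theta> * (b + K) \<le> 1" "\<theta> * (b + K)\<^sup>2 \<le> \<delta> / 4" "\<theta> * \<delta> \<le> 1"
    using exists_small_rate \<delta> by blast
  define C where "C = 2 * (\<delta> + K) / \<delta> * exp (\<theta> * (4 * (\<delta> + K) / \<delta>))"
  have C: "0 \<le> C" using \<delta> K by (simp add: C_def)
  (* The bound n * \<delta> keeps half of the slowest rate in the drift; exp (- 1) makes the logarithm at
     least 1, so that it absorbs the constant terms. *)
  define \<epsilon>0 where "\<epsilon>0 = min (exp (- 1)) (min (n * \<delta>) (total_service_rate S / 2))"
  define \<beta> where "\<beta> = 1 / 2 + 2 * n / \<theta> * (1 + n * real B * C) + n * real B / 2"
  have B: "k \<le> B" if "real k \<le> A_max \<or> real k \<le> S_max" for k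
    using that unfolding B_def by linarith
  have service_B: "AE x in measure_pmf S. x $ i \<le> B" for i
    using service_bounded[of i] by eventually_elim (simp add: B)
  show ?thesis
  proof (rule exI[of _ \<beta>], rule bexI[of _ \<epsilon>0], rule ballI)
    show "\<epsilon>0 \<in> {0<..<total_service_rate S}"
      using n \<delta> total by (auto simp: \<epsilon>0_def)
    fix \<epsilon> assume "\<epsilon> \<in> {0<..<\<epsilon>0}"
    then have \<epsilon>: "0 < \<epsilon>" "\<epsilon> < exp (- 1)" "\<epsilon> \<le> n * \<delta>" "\<epsilon> \<in> {0<..<total_service_rate S}"
      using total by (auto simp: \<epsilon>0_def)
    have \<epsilon>1: "\<epsilon> < 1" using \<epsilon>(2) exp_le_one_iff[of "- 1 :: real"] by linarith
    have L: "1 \<le> ln (1 / \<epsilon>)"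
    proof -
      have "exp 1 \<le> 1 / \<epsilon>" using \<epsilon> by (simp add: exp_minus field_simps)
      then show ?thesis using \<epsilon> by (subst ln_ge_iff) auto
    qed
    interpret jsq_system "M \<epsilon>" "a \<epsilon>" "s \<epsilon>" "av \<epsilon>" "u \<epsilon>" "q \<epsilon>"
      by (rule system[OF \<epsilon>(4)])
    have "AE \<omega> in M \<epsilon>. a \<epsilon> 1 \<omega> \<le> B"
      using arrival_bounded[OF \<epsilon>(4)] by eventually_elim (simp add: B)
    then interpret bounded_jsq_system "M \<epsilon>" "a \<epsilon>" "s \<epsilon>" "av \<epsilon>" "u \<epsilon>" "q \<epsilon>" B "service_mean S" \<epsilon>
        "variance (\<lambda>\<omega>. real (a \<epsilon> 1 \<omega>)) + (\<Sum>i\<in>UNIV. service_var S i)"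
      using bounded_jsq_systemI[OF service_law[OF \<epsilon>(4)] service_B service_uncorrelated _ arrival_rate[OF \<epsilon>(4)]]
      by blast
    have \<kappa>: "0 \<le> 1 / n" "1 / n * n \<le> 1" using n by auto
    have drift: "push (1 / n) x (sum (service_mean S) UNIV - \<epsilon>) (service_mean S)
        \<le> - \<delta> * sqrt (spread (1 / n) x)" for x :: "nat ^ 'n"
      unfolding n_def \<delta>_def
      by (rule push_balanced_le) (use \<mu> \<epsilon> in \<open>auto simp: n_def \<delta>_def\<close>)
    have "\<exists>d. \<forall>T. (\<Sum>k<T. started_exp m k (\<lambda>x _ _ _. exp (\<theta> * weight (1 / real CARD('n)) x))) \<le> C * real T + d" for m
      using exp_moment_bounds[OF \<kappa>[unfolded n_def] \<delta> drift[unfolded n_def] \<theta>(1)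
          \<theta>(2,3)[unfolded b_def K_def n_def] \<theta>(4), of m]
      unfolding C_def K_def n_def by blast
    note mean = steady_state_mean[OF \<epsilon>(1) \<epsilon>1 service_pos \<theta>(1) C this steady_state[OF \<epsilon>(4)], folded n_def]
    have "\<epsilon> / 2 + 2 * n / \<theta> * (ln (1 / \<epsilon>) + n * real B * C) + n * real B / 2 \<le> \<beta> * ln (1 / \<epsilon>)"
    proof -
      have "\<epsilon> / 2 \<le> 1 / 2 * ln (1 / \<epsilon>)" using \<epsilon>1 L by simp
      moreover have "n * real B / 2 \<le> n * real B / 2 * ln (1 / \<epsilon>)"
        using mult_left_mono[OF L, of "n * real B / 2"] n by simp
      moreover have "2 * n / \<theta> * (ln (1 / \<epsilon>) + n * real B * C)
          \<le> 2 * n / \<theta> * (ln (1 / \<epsilon>) + n * real B * C * ln (1 / \<epsilon>))"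
        using mult_left_mono[OF L, of "n * real B * C"] n C \<theta> by (intro mult_left_mono add_left_mono) auto
      ultimately show ?thesis
        unfolding \<beta>_def by (simp add: algebra_simps)
    qed
    with mean show "integrable (measure_pmf (qbar \<epsilon>)) (\<lambda>x. \<Sum>i\<in>UNIV. real (x $ i)) \<and>
      \<bar>measure_pmf.expectation (qbar \<epsilon>) (\<lambda>x. \<Sum>i\<in>UNIV. real (x $ i))
         - 1 / (2 * \<epsilon>) * (prob_space.variance (M \<epsilon>) (\<lambda>\<omega>. real (a \<epsilon> 1 \<omega>))
                         + (\<Sum>i\<in>UNIV. service_var S i))\<bar>
        \<le> \<beta> * ln (1 / \<epsilon>)"
      unfolding tot_def[abs_def] by simp
  qed
qed

end
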